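(* For each $\gamma\in\mathcal M_{\rm ac}$ there exists a unique $F\in\mathcal F$ such that, for all $x\in[0,1]$, $$F(x)=\alpha+(\beta-\alpha)\,\frac{A+\int_0^x\exp\big\{\int_0^y\mathcal R_\gamma(F;z)\,dz\big\}dy}{A+\int_0^1\exp\big\{\int_0^y\mathcal R_\gamma(F;z)\,dz\big\}dy+B\exp\big\{\int_0^1\mathcal R_\gamma(F;y)\,dy\big\}}.$$
   Context: Fix $0<\alpha<\beta<1$, $A>0$, $B>0$. $\nabla$ denotes the derivative in $x$. $\mathcal M_{\rm ac}$ is the set of (measurable) densities $\gamma:[0,1]\to[0,1]$ (identified with the measures $\gamma(x)dx$). $$\mathcal F=\{F\in C^1([0,1]):\ \alpha<F(x)<\beta,\ \nabla F(x)>0\ \ \forall x\in[0,1]\},\qquad \mathcal R_\gamma(F;x)=[\gamma(x)-F(x)]\,\frac{\nabla F(x)}{F(x)[1-F(x)]}.$$ *)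

theory Defs
  imports "HOL-Analysis.Analysis"
begin

definition M_ac :: "(real \<Rightarrow> real) set" where
  "M_ac = {\<gamma>. \<gamma> \<in> borel_measurable (lebesgue_on {0..1}) \<and> (\<forall>x\<in>{0..1}. 0 \<le> \<gamma> x \<and> \<gamma> x \<le> 1)}"

text \<open>One-sided at the endpoints, so that the derivative depends only on the values of the
  function on the unit interval.\<close>
definition nabla :: "(real \<Rightarrow> real) \<Rightarrow> real \<Rightarrow> real" where
  "nabla F x = vector_derivative F (at x within {0..1})"

text \<open>A function with domain the unit interval is represented by the total function that is
  \<^term>\<open>undefined\<close> elsewhere (\<^const>\<open>extensional\<close>), so that equality of such functions is
  equality on the unit interval.\<close>
definition C1_01 :: "(real \<Rightarrow> real) set" where
  "C1_01 = {F \<in> extensional {0..1}. F differentiable_on {0..1} \<and> continuous_on {0..1} (nabla F)}"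

definition F_class :: "real \<Rightarrow> real \<Rightarrow> (real \<Rightarrow> real) set" where
  "F_class \<alpha> \<beta> = {F \<in> C1_01. \<forall>x\<in>{0..1}. \<alpha> < F x \<and> F x < \<beta> \<and> nabla F x > 0}"

definition R_op :: "(real \<Rightarrow> real) \<Rightarrow> (real \<Rightarrow> real) \<Rightarrow> real \<Rightarrow> real" where
  "R_op \<gamma> F x = (\<gamma> x - F x) * (nabla F x / (F x * (1 - F x)))"

end

theory Submission
  imports Defs
begin

text \<open>Write \<open>\<phi>\<close> for the logit of \<open>F\<close> and \<open>u = F (1 - F) / F'\<close>. Up to integrating once, the fixed point
  equation is the ordinary differential equation \<open>\<phi>' = 1 / u\<close>, \<open>u' = 1 - \<gamma> - F\<close> with the boundary
  conditions \<open>F 0 = \<alpha> + A F' 0\<close> and \<open>F 1 = \<beta> - B F' 1\<close>. Shoot with the parameter \<open>c = F' 0\<close>. Enlarging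
  \<open>c\<close> raises \<open>\<phi> 0\<close> and lowers \<open>u 0\<close>, and the system propagates this order: \<open>\<phi>\<close> stays larger and \<open>u\<close>
  smaller. The condition at \<open>1\<close> reads \<open>u 1 = B F (1 - F) / (\<beta> - F)\<close>, whose right-hand side increases
  with \<open>F 1\<close>, so at most one \<open>c\<close> meets it. For existence, \<open>1 / u\<close> is replaced by \<open>1 / max e u\<close>, which
  makes the system globally Lipschitz; the intermediate value theorem gives \<open>c\<close>, and for small \<open>e\<close> the
  truncation is inactive on the solution found.\<close>

subsection \<open>The logistic function and Gronwall's inequality\<close>

definition logistic :: "real \<Rightarrow> real" where
  "logistic t = 1 / (1 + exp (- t))"

definition logit :: "real \<Rightarrow> real" where
  "logit y = ln y - ln (1 - y)"

lemma logistic_pos: "0 < logistic t"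
  by (simp add: logistic_def add_pos_pos)

lemma logistic_less_1: "logistic t < 1"
  by (simp add: logistic_def add_pos_pos)

lemma logistic_less_iff [simp]: "logistic s < logistic t \<longleftrightarrow> s < t"
  by (simp add: logistic_def add_pos_pos frac_less2 divide_less_eq less_divide_eq)

lemma logistic_le_iff [simp]: "logistic s \<le> logistic t \<longleftrightarrow> s \<le> t"
  by (meson logistic_less_iff not_less)

lemma logistic_logit: "0 < y \<Longrightarrow> y < 1 \<Longrightarrow> logistic (logit y) = y"
  by (simp add: logistic_def logit_def exp_diff field_simps)

lemma logistic_has_derivative:
  "(logistic has_real_derivative logistic t * (1 - logistic t)) (at t within S)"
proof -
  have "1 + exp (- t) \<noteq> 0"
    using exp_gt_zero[of "- t"] by linarith
  then show ?thesis
    unfolding logistic_def by (auto intro!: derivative_eq_intros simp: field_simps)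
qed

lemma logit_has_derivative:
  assumes "0 < y" "y < 1"
  shows "(logit has_real_derivative 1 / (y * (1 - y))) (at y within S)"
  unfolding logit_def using assms
  by (auto intro!: derivative_eq_intros simp: field_simps)

lemma continuous_on_logistic [continuous_intros]:
  assumes "continuous_on S f"
  shows "continuous_on S (\<lambda>x. logistic (f x))"
  by (rule continuous_on_compose2[OF DERIV_continuous_on[OF logistic_has_derivative] assms])
     (rule subset_UNIV)

lemma logistic_lipschitz: "\<bar>logistic s - logistic t\<bar> \<le> \<bar>s - t\<bar>"
proof -
  have "norm (logistic x * (1 - logistic x)) \<le> 1" for x
    using logistic_pos[of x] logistic_less_1[of x] by (auto simp: abs_mult intro!: mult_le_one)
  then have "norm (logistic s - logistic t) \<le> 1 * norm (s - t)"
    by (intro field_differentiable_bound[of UNIV logistic "\<lambda>x. logistic x * (1 - logistic x)"])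
       (auto intro: logistic_has_derivative)
  then show ?thesis by simp
qed

text \<open>Damped by \<open>exp (- L * y)\<close>, the right-hand side of the hypothesis has a
  nonpositive derivative, so it never exceeds its initial value \<open>a\<close>.\<close>

lemma gronwall:
  fixes f :: "real \<Rightarrow> real"
  assumes cont: "continuous_on {0..1} f" and L: "0 \<le> L"
    and le: "\<And>x. x \<in> {0..1} \<Longrightarrow> f x \<le> a + L * integral {0..x} f"
    and x: "x \<in> {0..1}"
  shows "f x \<le> a * exp (L * x)"
proof -
  define E where "E = (\<lambda>y. exp (- L * y) * (a + L * integral {0..y} f))"
  have D: "(E has_real_derivative exp (- L * y) * L * (f y - (a + L * integral {0..y} f)))
            (at y within {0..1})" if "y \<in> {0..1}" for y
  proof -
    have 1: "((\<lambda>y. a + L * integral {0..y} f) has_real_derivative 0 + L * f y) (at y within {0..1})"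
      by (rule DERIV_add[OF DERIV_const DERIV_cmult[OF integral_has_real_derivative[OF cont that]]])
    have 2: "((\<lambda>y. exp (- L * y)) has_real_derivative - L * exp (- L * y)) (at y within {0..1})"
      by (auto intro!: derivative_eq_intros)
    show ?thesis
      unfolding E_def using DERIV_mult[OF 2 1] by (simp add: algebra_simps)
  qed
  have "E x \<le> E 0"
  proof (rule DERIV_nonpos_imp_decreasing_open[where f = E and a = 0 and b = x])
    show "0 \<le> x" using x by auto
    show "\<exists>d. (E has_real_derivative d) (at y) \<and> d \<le> 0" if "0 < y" "y < x" for y
    proof -
      have y: "y \<in> {0..1}" "y \<in> interior {0..1}" using that x by auto
      have "exp (- L * y) * L * (f y - (a + L * integral {0..y} f)) \<le> 0"
        using le[OF y(1)] L by (intro mult_nonneg_nonpos) auto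
      with D[OF y(1)] show ?thesis
        by (subst (asm) at_within_interior[OF y(2)]) blast
    qed
    show "continuous_on {0..x} E"
      using x by (intro continuous_on_subset[OF DERIV_continuous_on[OF D]]) auto
  qed
  then have "exp (- L * x) * (a + L * integral {0..x} f) \<le> a"
    by (simp add: E_def)
  then have "exp (L * x) * (exp (- L * x) * (a + L * integral {0..x} f)) \<le> exp (L * x) * a"
    by (rule mult_left_mono) simp
  then have "a + L * integral {0..x} f \<le> a * exp (L * x)"
    by (simp add: mult.assoc[symmetric] exp_add[symmetric] mult.commute)
  with le[OF x] show ?thesis by simp
qed

subsection \<open>The truncated initial value problem\<close>

text \<open>This is \<open>u\<close> of the overview as a functional of \<phi>, with
  \<open>v\<close> as initial value and \<open>H\<close> in the role of the primitive of
  \<open>1 - \<gamma>\<close>. Since \<gamma> is only measurable, the equation for \<open>u\<close>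
  is kept in integrated form; eliminating \<open>u\<close> leaves one fixed point equation for
  \<phi>.\<close>

definition drift :: "(real \<Rightarrow> real) \<Rightarrow> real \<Rightarrow> (real \<Rightarrow> real) \<Rightarrow> real \<Rightarrow> real" where
  "drift H v \<phi> x = v + H x - integral {0..x} (\<lambda>z. logistic (\<phi> z))"

definition picard :: "(real \<Rightarrow> real) \<Rightarrow> real \<Rightarrow> real \<Rightarrow> real \<Rightarrow> (real \<Rightarrow> real) \<Rightarrow> real \<Rightarrow> real" where
  "picard H e p v \<phi> x = p + integral {0..x} (\<lambda>y. 1 / max e (drift H v \<phi> y))"

definition solves :: "(real \<Rightarrow> real) \<Rightarrow> real \<Rightarrow> real \<Rightarrow> real \<Rightarrow> (real \<Rightarrow> real) \<Rightarrow> bool" where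
  "solves H e p v \<phi> \<longleftrightarrow>
     continuous_on {0..1} \<phi> \<and> (\<forall>x\<in>{0..1}. \<phi> x = picard H e p v \<phi> x)"

lemma drift_continuous:
  assumes "continuous_on {0..1} H" "(\<lambda>z. logistic (\<phi> z)) integrable_on {0..1}"
  shows "continuous_on {0..1} (drift H v \<phi>)"
  unfolding drift_def[abs_def]
  by (rule continuous_on_diff[OF continuous_on_add[OF continuous_on_const assms(1)]
        indefinite_integral_continuous_1[OF assms(2)]])

lemma speed_continuous:
  assumes "continuous_on {0..1} H" "(\<lambda>z. logistic (\<phi> z)) integrable_on {0..1}" "0 < e"
  shows "continuous_on {0..1} (\<lambda>y. 1 / max e (drift H v \<phi> y))"
  using \<open>0 < e\<close> by (intro continuous_on_divide continuous_on_const continuous_on_max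
      drift_continuous assms(1,2)) auto

lemma logistic_integrable:
  fixes \<phi> :: "real \<Rightarrow> real"
  shows "continuous_on {0..1} \<phi> \<Longrightarrow> (\<lambda>z. logistic (\<phi> z)) integrable_on {0..1}"
  by (rule integrable_continuous_real) (rule continuous_on_logistic)

lemma integrable_prefix:
  fixes f :: "real \<Rightarrow> real"
  assumes "f integrable_on {0..1}" "x \<in> {0..1}"
  shows "f integrable_on {0..x}"
  using assms by (auto intro: integrable_subinterval_real)

lemma picard_continuous:
  assumes "continuous_on {0..1} H" "(\<lambda>z. logistic (\<phi> z)) integrable_on {0..1}" "0 < e"
  shows "continuous_on {0..1} (picard H e p v \<phi>)"
  unfolding picard_def[abs_def]
  by (intro continuous_on_add continuous_on_const indefinite_integral_continuous_1
      integrable_continuous_real speed_continuous[OF assms])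

section \<open>Order preservation and existence by monotone iteration\<close>

lemma drift_antimono:
  assumes "(\<lambda>z. logistic (\<phi> z)) integrable_on {0..1}" "(\<lambda>z. logistic (\<psi> z)) integrable_on {0..1}"
    and "\<And>z. z \<in> {0..1} \<Longrightarrow> \<phi> z \<le> \<psi> z" "w \<le> v" "x \<in> {0..1}"
  shows "drift H w \<psi> x \<le> drift H v \<phi> x"
proof -
  have "integral {0..x} (\<lambda>z. logistic (\<phi> z)) \<le> integral {0..x} (\<lambda>z. logistic (\<psi> z))"
    using assms by (intro integral_le integrable_prefix[OF _ \<open>x \<in> {0..1}\<close>]) auto
  with \<open>w \<le> v\<close> show ?thesis by (simp add: drift_def)
qed

text \<open>Monotonicity yields a solution as the limit of an increasing iteration, and the comparison
  principle through the iterates.\<close>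
lemma picard_mono:
  assumes H: "continuous_on {0..1} H" and e: "0 < e"
    and i: "(\<lambda>z. logistic (\<phi> z)) integrable_on {0..1}" "(\<lambda>z. logistic (\<psi> z)) integrable_on {0..1}"
    and "\<And>z. z \<in> {0..1} \<Longrightarrow> \<phi> z \<le> \<psi> z" "w \<le> v" "p \<le> q" and x: "x \<in> {0..1}"
  shows "picard H e p v \<phi> x \<le> picard H e q w \<psi> x"
proof -
  have "integral {0..x} (\<lambda>y. 1 / max e (drift H v \<phi> y)) \<le>
        integral {0..x} (\<lambda>y. 1 / max e (drift H w \<psi> y))"
  proof (rule integral_le)
    fix y assume "y \<in> {0..x}"
    then have "drift H w \<psi> y \<le> drift H v \<phi> y"
      using assms(5,6) x by (intro drift_antimono i) auto
    then have "max e (drift H w \<psi> y) \<le> max e (drift H v \<phi> y)"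
      by linarith
    moreover have "0 < max e (drift H w \<psi> y)" using e by linarith
    ultimately show "1 / max e (drift H v \<phi> y) \<le> 1 / max e (drift H w \<psi> y)"
      by (rule frac_le[OF zero_le_one order_refl, rotated])
  qed (intro integrable_prefix[OF _ x] integrable_continuous_real speed_continuous H e i)+
  with \<open>p \<le> q\<close> show ?thesis by (simp add: picard_def)
qed

text \<open>The truncation keeps the integrand between 0 and \<open>1 / e\<close>. The lower bound
  starts the increasing iteration, and the upper bound makes it converge.\<close>

lemma picard_bounds:
  assumes H: "continuous_on {0..1} H" and e: "0 < e"
    and i: "(\<lambda>z. logistic (\<phi> z)) integrable_on {0..1}" and x: "x \<in> {0..1}"
  shows "p \<le> picard H e p v \<phi> x" "picard H e p v \<phi> x \<le> p + 1 / e"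
proof -
  let ?f = "\<lambda>y. 1 / max e (drift H v \<phi> y)"
  have f: "?f integrable_on {0..x}"
    by (intro integrable_prefix[OF _ x] integrable_continuous_real speed_continuous H i e)
  have "0 \<le> integral {0..x} ?f"
    using e f by (intro integral_nonneg) (auto simp: max_def)
  then show "p \<le> picard H e p v \<phi> x" by (simp add: picard_def)
  have "integral {0..x} ?f \<le> integral {0..x} (\<lambda>_. 1 / e)"
    using e f by (intro integral_le) (auto intro!: divide_left_mono)
  also have "\<dots> \<le> 1 / e"
    using x e by (simp add: divide_right_mono)
  finally show "picard H e p v \<phi> x \<le> p + 1 / e" by (simp add: picard_def)
qed

text \<open>The constant \<open>p\<close> lies below its own image under \<open>picard\<close> when
  \<open>e\<close> is positive, so iterating the monotone operator from it gives an increasing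
  sequence.\<close>

primrec picard_seq ::
  "(real \<Rightarrow> real) \<Rightarrow> real \<Rightarrow> real \<Rightarrow> real \<Rightarrow> nat \<Rightarrow> real \<Rightarrow> real" where
  "picard_seq H e p v 0 = (\<lambda>_. p)"
| "picard_seq H e p v (Suc n) = picard H e p v (picard_seq H e p v n)"

lemma picard_seq_continuous:
  assumes "continuous_on {0..1} H" "0 < e"
  shows "continuous_on {0..1} (picard_seq H e p v n)"
  by (induction n) (auto intro!: picard_continuous logistic_integrable assms)

lemma picard_seq_Suc_le:
  assumes H: "continuous_on {0..1} H" and e: "0 < e" and "x \<in> {0..1}"
  shows "picard_seq H e p v n x \<le> picard_seq H e p v (Suc n) x"
  using \<open>x \<in> {0..1}\<close>
proof (induction n arbitrary: x)
  case 0
  then show ?case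
    by (auto intro!: picard_bounds H e)
next
  case (Suc n)
  have "picard H e p v (picard_seq H e p v n) x
      \<le> picard H e p v (picard_seq H e p v (Suc n)) x"
    by (rule picard_mono[OF H e]; use Suc in
        \<open>auto intro!: logistic_integrable picard_continuous picard_seq_continuous H e
          simp del: picard_seq.simps(2)\<close>)
  then show ?case by simp
qed

lemma picard_seq_mono_param:
  assumes H: "continuous_on {0..1} H" and e: "0 < e" and "p \<le> q" "w \<le> v" "x \<in> {0..1}"
  shows "picard_seq H e p v n x \<le> picard_seq H e q w n x"
  using \<open>x \<in> {0..1}\<close>
proof (induction n arbitrary: x)
  case (Suc n)
  show ?case
    unfolding picard_seq.simps
    by (rule picard_mono[OF H e]; use Suc assms in
        \<open>auto intro!: logistic_integrable picard_seq_continuous\<close>)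
qed (use assms in simp)

lemma picard_seq_convergent:
  assumes H: "continuous_on {0..1} H" and e: "0 < e" and x: "x \<in> {0..1}"
  shows "(\<lambda>n. picard_seq H e p v n x) \<longlonglongrightarrow> lim (\<lambda>n. picard_seq H e p v n x)"
proof -
  have "incseq (\<lambda>n. picard_seq H e p v n x)"
    by (rule incseq_SucI) (rule picard_seq_Suc_le[OF assms])
  moreover have "picard_seq H e p v n x \<le> p + 1 / e" for n
    using e x by (cases n) (auto intro!: picard_bounds H logistic_integrable picard_seq_continuous)
  ultimately show ?thesis
    by (metis incseq_convergent limI)
qed

text \<open>Dominated convergence passes to the limit in both nested integrals, with bound 1 for the
  logistic term and \<open>1 / e\<close> for the speed. The limit is at first only pointwise, so
  integrability of its logistic image comes from dominated convergence as well; continuity follows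
  at the end, from the fixed point equation.\<close>

lemma solution_exists:
  assumes H: "continuous_on {0..1} H" and e: "0 < e"
  shows "solves H e p v (\<lambda>x. lim (\<lambda>n. picard_seq H e p v n x))" (is "solves _ _ _ _ ?\<phi>")
proof -
  let ?s = "picard_seq H e p v"
  note lim = picard_seq_convergent[OF H e]
  note si = logistic_integrable[OF picard_seq_continuous[OF H e]]
  have L: "(\<lambda>n. logistic (?s n z)) \<longlonglongrightarrow> logistic (?\<phi> z)" if "z \<in> {0..1}" for z
    using continuous_on_tendsto_compose[OF continuous_on_logistic[OF continuous_on_id, of UNIV] lim[OF that]]
    by simp
  have b: "norm (logistic t) \<le> 1" for t
    using logistic_pos[of t] logistic_less_1[of t] by simp
  have dc: "(\<lambda>z. logistic (?\<phi> z)) integrable_on {0..x} \<and>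
      (\<lambda>n. integral {0..x} (\<lambda>z. logistic (?s n z))) \<longlonglongrightarrow> integral {0..x} (\<lambda>z. logistic (?\<phi> z))"
    if "x \<in> {0..1}" for x
    using dominated_convergence[of "\<lambda>n z. logistic (?s n z)" "{0..x}" "\<lambda>_. 1" "\<lambda>z. logistic (?\<phi> z)"]
      that L b integrable_prefix[OF si that]
    by (auto simp: that)
  have i: "(\<lambda>z. logistic (?\<phi> z)) integrable_on {0..1}"
    using dc[of 1] by simp
  have D: "(\<lambda>n. drift H v (?s n) y) \<longlonglongrightarrow> drift H v ?\<phi> y" if "y \<in> {0..1}" for y
    unfolding drift_def[abs_def] using dc[OF that] by (intro tendsto_intros) auto
  have "(\<lambda>n. picard H e p v (?s n) x) \<longlonglongrightarrow> picard H e p v ?\<phi> x" if x: "x \<in> {0..1}" for x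
  proof -
    have "(\<lambda>n. integral {0..x} (\<lambda>y. 1 / max e (drift H v (?s n) y)))
        \<longlonglongrightarrow> integral {0..x} (\<lambda>y. 1 / max e (drift H v ?\<phi> y))"
    proof (rule dominated_convergence(2)[where h = "\<lambda>_. 1 / e"])
      show "(\<lambda>y. 1 / max e (drift H v (?s n) y)) integrable_on {0..x}" for n
        by (intro integrable_prefix[OF _ x] integrable_continuous_real speed_continuous H si e)
      show "norm (1 / max e (drift H v (?s n) y)) \<le> 1 / e" for n y
        using e by (auto simp: max_def intro!: divide_left_mono)
      show "(\<lambda>n. 1 / max e (drift H v (?s n) y)) \<longlonglongrightarrow> 1 / max e (drift H v ?\<phi> y)"
        if "y \<in> {0..x}" for y
        using e x that by (intro tendsto_intros D) (auto simp: max_def)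
    qed auto
    then show ?thesis unfolding picard_def by (intro tendsto_intros)
  qed
  moreover have "(\<lambda>n. picard H e p v (?s n) x) \<longlonglongrightarrow> ?\<phi> x" if "x \<in> {0..1}" for x
    using LIMSEQ_Suc[OF lim[OF that]] by simp
  ultimately have eq: "?\<phi> x = picard H e p v ?\<phi> x" if "x \<in> {0..1}" for x
    using LIMSEQ_unique that by blast
  have "continuous_on {0..1} ?\<phi>"
    using picard_continuous[OF H i e] by (subst continuous_on_cong[OF refl eq]) auto
  with eq show ?thesis by (simp add: solves_def)
qed

section \<open>Continuous dependence, uniqueness and comparison for the truncated problem\<close>

lemma solves_drift_continuous:
  assumes "continuous_on {0..1} H" "solves H e p v \<phi>"
  shows "continuous_on {0..1} (drift H v \<phi>)"
  using assms by (auto intro!: drift_continuous logistic_integrable simp: solves_def)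

lemma recip_max_lipschitz:
  fixes e :: real
  assumes "0 < e"
  shows "\<bar>1 / max e s - 1 / max e t\<bar> \<le> \<bar>s - t\<bar> / e\<^sup>2"
proof -
  let ?a = "max e s" and ?b = "max e t"
  have ab: "e \<le> ?a" "e \<le> ?b" by auto
  then have pos: "0 < ?a" "0 < ?b" using assms by linarith+
  have "\<bar>1 / ?a - 1 / ?b\<bar> = \<bar>?b - ?a\<bar> / (?a * ?b)"
    using pos by (simp add: abs_mult diff_frac_eq abs_divide)
  also have "\<dots> \<le> \<bar>s - t\<bar> / (?a * ?b)"
    using pos by (intro divide_right_mono) (auto simp: max_def)
  also have "\<dots> \<le> \<bar>s - t\<bar> / (e * e)"
    using ab assms pos by (intro divide_left_mono mult_mono) auto
  finally show ?thesis by (simp add: power2_eq_square)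
qed

text \<open>The gap between the drifts is controlled by the integral of the gap between \<phi> and
  \<psi> (constant 1), and the latter by the integral of the former (constant
  \<open>1 / e\<^sup>2\<close>). Their sum therefore satisfies a Gronwall inequality with the sum of
  the two constants.\<close>

lemma solution_dependence:
  assumes H: "continuous_on {0..1} H" and e: "0 < e"
    and s: "solves H e p v \<phi>" "solves H e q w \<psi>" and x: "x \<in> {0..1}"
  shows "\<bar>\<phi> x - \<psi> x\<bar> + \<bar>drift H v \<phi> x - drift H w \<psi> x\<bar>
     \<le> (\<bar>p - q\<bar> + \<bar>v - w\<bar>) * exp (1 + 1 / e\<^sup>2)"
proof -
  let ?L = "1 + 1 / e\<^sup>2"
  let ?m = "\<lambda>y. \<bar>\<phi> y - \<psi> y\<bar>" and ?d = "\<lambda>y. \<bar>drift H v \<phi> y - drift H w \<psi> y\<bar>"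
  have cont: "continuous_on {0..1} \<phi>" "continuous_on {0..1} \<psi>"
    using s by (auto simp: solves_def)
  have cd: "continuous_on {0..1} (drift H v \<phi>)" "continuous_on {0..1} (drift H w \<psi>)"
    using solves_drift_continuous[OF H] s by auto
  have L: "0 \<le> ?L" by simp
  have cm: "continuous_on {0..1} ?m" "continuous_on {0..1} ?d"
    by (intro continuous_intros cont cd)+
  have "?m x + ?d x \<le> (\<bar>p - q\<bar> + \<bar>v - w\<bar>) * exp (?L * x)"
  proof (rule gronwall[OF _ L _ x])
    show "continuous_on {0..1} (\<lambda>y. ?m y + ?d y)"
      by (intro continuous_intros cm)
    fix y :: real assume y: "y \<in> {0..1}"
    note ic = integrable_prefix[OF integrable_continuous_real y]
    have I: "?m integrable_on {0..y}" "?d integrable_on {0..y}" by (intro ic cm)+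
    have pos: "0 \<le> integral {0..y} ?m" "0 \<le> integral {0..y} ?d"
      by (auto intro!: integral_nonneg I)
    have "?d y \<le> \<bar>v - w\<bar> + \<bar>integral {0..y} (\<lambda>z. logistic (\<phi> z)) - integral {0..y} (\<lambda>z. logistic (\<psi> z))\<bar>"
      by (simp add: drift_def)
    also have "integral {0..y} (\<lambda>z. logistic (\<phi> z)) - integral {0..y} (\<lambda>z. logistic (\<psi> z))
       = integral {0..y} (\<lambda>z. logistic (\<phi> z) - logistic (\<psi> z))"
      by (intro integral_diff[symmetric] ic continuous_intros cont)
    also have "\<bar>\<dots>\<bar> \<le> integral {0..y} ?m"
      using integral_norm_bound_integral[of "\<lambda>z. logistic (\<phi> z) - logistic (\<psi> z)" "{0..y}" ?m] logistic_lipschitz I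
      by (simp add: ic cont continuous_intros)
    finally have d: "?d y \<le> \<bar>v - w\<bar> + integral {0..y} ?m" by simp
    have sp: "continuous_on {0..1} (\<lambda>y. 1 / max e (drift H v \<phi> y))"
       "continuous_on {0..1} (\<lambda>y. 1 / max e (drift H w \<psi> y))"
      by (intro speed_continuous H e logistic_integrable cont)+
    have "?m y \<le> \<bar>p - q\<bar> + \<bar>integral {0..y} (\<lambda>z. 1 / max e (drift H v \<phi> z)) - integral {0..y} (\<lambda>z. 1 / max e (drift H w \<psi> z))\<bar>"
      using s y by (simp add: solves_def picard_def)
    also have "integral {0..y} (\<lambda>z. 1 / max e (drift H v \<phi> z)) - integral {0..y} (\<lambda>z. 1 / max e (drift H w \<psi> z))
       = integral {0..y} (\<lambda>z. 1 / max e (drift H v \<phi> z) - 1 / max e (drift H w \<psi> z))"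
      by (intro integral_diff[symmetric] ic sp)
    also have "\<bar>\<dots>\<bar> \<le> integral {0..y} (\<lambda>z. ?d z / e\<^sup>2)"
      using integral_norm_bound_integral[of "\<lambda>z. 1 / max e (drift H v \<phi> z) - 1 / max e (drift H w \<psi> z)" "{0..y}" "\<lambda>z. ?d z / e\<^sup>2"]
        recip_max_lipschitz[OF e] I
      by (simp add: integrable_diff ic sp integrable_on_divide)
    also have "\<dots> = integral {0..y} ?d / e\<^sup>2" by simp
    finally have m: "?m y \<le> \<bar>p - q\<bar> + integral {0..y} ?d / e\<^sup>2" by simp
    have "integral {0..y} ?m + integral {0..y} ?d / e\<^sup>2
        \<le> ?L * (integral {0..y} ?m + integral {0..y} ?d)"
      using pos by (simp add: algebra_simps)
    with d m show "?m y + ?d y \<le> \<bar>p - q\<bar> + \<bar>v - w\<bar> + ?L * integral {0..y} (\<lambda>y. ?m y + ?d y)"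
      by (simp add: integral_add I)
  qed
  also have "\<dots> \<le> (\<bar>p - q\<bar> + \<bar>v - w\<bar>) * exp ?L"
  proof (rule mult_left_mono)
    have "?L * x \<le> ?L * 1" using x L by (intro mult_left_mono) auto
    then show "exp (?L * x) \<le> exp ?L" by simp
  qed simp
  finally show ?thesis .
qed

lemma solution_unique:
  assumes "continuous_on {0..1} H" "0 < e" "solves H e p v \<phi>" "solves H e p v \<psi>" "x \<in> {0..1}"
  shows "\<phi> x = \<psi> x"
  using solution_dependence[OF assms] by simp

text \<open>By uniqueness both solutions are the limits of their Picard sequences, and these
  sequences are ordered term by term.\<close>

lemma solution_comparison:
  assumes H: "continuous_on {0..1} H" and e: "0 < e"
    and s: "solves H e p v \<phi>" "solves H e q w \<psi>" and le: "p \<le> q" "w \<le> v" and x: "x \<in> {0..1}"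
  shows "\<phi> x \<le> \<psi> x"
proof -
  have "\<phi> x = lim (\<lambda>n. picard_seq H e p v n x)" "\<psi> x = lim (\<lambda>n. picard_seq H e q w n x)"
    using solution_unique[OF H e _ solution_exists[OF H e] x] s by auto
  moreover have "lim (\<lambda>n. picard_seq H e p v n x) \<le> lim (\<lambda>n. picard_seq H e q w n x)"
    by (rule LIMSEQ_le[OF picard_seq_convergent[OF H e x] picard_seq_convergent[OF H e x]])
       (auto intro!: picard_seq_mono_param H e le x)
  ultimately show ?thesis by simp
qed

subsection \<open>Chain rules for primitives of bounded measurable functions\<close>

lemma M_ac_absolutely_integrable:
  assumes "\<gamma> \<in> M_ac" "continuous_on {0..1} k"
  shows "(\<lambda>z. \<gamma> z * k z) absolutely_integrable_on {0..1}"
proof (rule absolutely_integrable_bounded_measurable_product_real)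
  show "\<gamma> \<in> borel_measurable (lebesgue_on {0..1})" "bounded (\<gamma> ` {0..1})"
    using assms(1) by (auto simp: M_ac_def bounded_iff intro!: exI[of _ 1])
  show "k absolutely_integrable_on {0..1}"
    by (rule absolutely_integrable_continuous_real[OF assms(2)])
qed auto

lemma M_ac_integrable: "\<gamma> \<in> M_ac \<Longrightarrow> \<gamma> integrable_on {0..1}"
  using set_lebesgue_integral_eq_integral(1)[OF M_ac_absolutely_integrable[of \<gamma> "\<lambda>_. 1"]]
  by simp

lemma integral_difference_bounds:
  fixes f :: "real \<Rightarrow> real"
  assumes f: "f integrable_on {0..1}" and b: "\<And>z. z \<in> {0..1} \<Longrightarrow> 0 \<le> f z \<and> f z \<le> 1"
    and xy: "0 \<le> x" "x \<le> y" "y \<le> 1"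
  shows "0 \<le> integral {0..y} f - integral {0..x} f" "integral {0..y} f - integral {0..x} f \<le> y - x"
proof -
  have i: "f integrable_on {0..y}" "f integrable_on {x..y}"
    using f xy by (auto intro: integrable_subinterval_real)
  have eq: "integral {0..y} f - integral {0..x} f = integral {x..y} f"
    using Henstock_Kurzweil_Integration.integral_combine[OF xy(1,2) i(1)] by simp
  show "0 \<le> integral {0..y} f - integral {0..x} f"
    unfolding eq using b xy by (intro integral_nonneg i) auto
  have "integral {x..y} f \<le> integral {x..y} (\<lambda>_. 1)"
    using b xy by (intro integral_le i) auto
  then show "integral {0..y} f - integral {0..x} f \<le> y - x"
    unfolding eq using xy by simp
qed

lemma M_ac_primitive_lipschitz:
  assumes "\<gamma> \<in> M_ac" "x \<in> {0..1}" "y \<in> {0..1}"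
  shows "\<bar>integral {0..y} \<gamma> - integral {0..x} \<gamma>\<bar> \<le> \<bar>y - x\<bar>"
proof -
  have b: "0 \<le> \<gamma> z \<and> \<gamma> z \<le> 1" if "z \<in> {0..1}" for z
    using assms(1) that by (auto simp: M_ac_def)
  note I = integral_difference_bounds[OF M_ac_integrable[OF assms(1)] b]
  show ?thesis
    using I[of x y] I[of y x] assms(2,3) by (cases "x \<le> y") auto
qed

text \<open>The primitive of \<open>\<gamma>\<close> need not be differentiable at a given \<open>x\<close>, but after freezing the
  coefficient \<open>k\<close> at \<open>x\<close> the integrand is continuous at \<open>x\<close>. Subtracting multiples of the primitive of
  \<open>\<gamma>\<close> in this way gives pointwise derivatives throughout, without any almost-everywhere calculus.\<close>
lemma primitive_frozen_coefficient:
  assumes g: "\<gamma> \<in> M_ac" and k: "continuous_on {0..1} k" and h: "continuous_on {0..1} h"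
    and x: "x \<in> {0..1}"
  shows "((\<lambda>y. integral {0..y} (\<lambda>z. \<gamma> z * k z + h z) - k x * integral {0..y} \<gamma>)
           has_real_derivative h x) (at x within {0..1})"
proof -
  let ?f = "\<lambda>z. \<gamma> z * (k z - k x) + h z"
  have i1: "(\<lambda>z. \<gamma> z * k z + h z) integrable_on {0..1}"
    using set_lebesgue_integral_eq_integral(1)[OF M_ac_absolutely_integrable[OF g k]]
    by (rule integrable_add[OF _ integrable_continuous_real[OF h]])
  have i2: "(\<lambda>z. k x * \<gamma> z) integrable_on {0..1}"
    by (intro integrable_on_mult_right M_ac_integrable g)
  have eqf: "?f = (\<lambda>z. (\<gamma> z * k z + h z) - k x * \<gamma> z)"
    by (auto simp: algebra_simps)
  have i: "?f integrable_on {0..1}"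
    unfolding eqf by (rule integrable_diff[OF i1 i2])
  have k0: "((\<lambda>z. k z - k x) \<longlongrightarrow> 0) (at x within {0..1})"
    using k x by (auto simp: continuous_on_def intro: LIM_zero)
  have "((\<lambda>z. \<gamma> z * (k z - k x)) \<longlongrightarrow> 0) (at x within {0..1})"
  proof (rule Lim_null_comparison)
    show "\<forall>\<^sub>F z in at x within {0..1}. norm (\<gamma> z * (k z - k x)) \<le> \<bar>k z - k x\<bar>"
      using g by (auto simp: eventually_at_filter M_ac_def abs_mult intro!: always_eventually mult_left_le_one_le)
    show "((\<lambda>z. \<bar>k z - k x\<bar>) \<longlongrightarrow> 0) (at x within {0..1})"
      using tendsto_rabs_zero[OF k0] .
  qed
  moreover have "(h \<longlongrightarrow> h x) (at x within {0..1})"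
    using h x by (auto simp: continuous_on_def)
  ultimately have "continuous (at x within {0..1}) ?f"
    using tendsto_add[of "\<lambda>z. \<gamma> z * (k z - k x)" 0 _ h "h x"] by (simp add: continuous_within)
  then have "((\<lambda>y. integral {0..y} ?f) has_vector_derivative ?f x) (at x within {0..1} - {})"
    using x by (intro integral_has_vector_derivative_continuous_at i) simp_all
  then have "((\<lambda>y. integral {0..y} ?f) has_real_derivative h x) (at x within {0..1})"
    by (simp add: has_real_derivative_iff_has_vector_derivative)
  moreover have "integral {0..y} ?f =
      integral {0..y} (\<lambda>z. \<gamma> z * k z + h z) - k x * integral {0..y} \<gamma>" if "y \<in> {0..1}" for y
    unfolding eqf
    by (subst integral_diff[OF integrable_prefix[OF i1 that] integrable_prefix[OF i2 that]]) simp
  ultimately show ?thesis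
    by (rule has_field_derivative_transform_within[OF _ zero_less_one x])
qed

text \<open>Here \<open>w\<close> itself may fail to be differentiable at \<open>x\<close>; only its
  sum with \<open>\<kappa> * \<Gamma>\<close> is known to be. With the Caratheodory slope
  \<open>q\<close> of \<open>f\<close> at \<open>w x\<close>, the new difference quotient is
  \<open>q (w y)\<close> times the given one plus \<open>(f' - q (w y)) * \<kappa>\<close> times
  that of \<Gamma>. The last quotient is bounded by 1 and its coefficient tends to 0.\<close>

lemma chain_rule_modulo_lipschitz:
  fixes w \<Gamma> f :: "real \<Rightarrow> real"
  assumes P: "((\<lambda>y. w y + \<kappa> * \<Gamma> y) has_real_derivative D) (at x within S)"
    and \<Gamma>: "\<And>y. y \<in> S \<Longrightarrow> \<bar>\<Gamma> y - \<Gamma> x\<bar> \<le> \<bar>y - x\<bar>"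
    and f: "(f has_real_derivative f') (at (w x))"
  shows "((\<lambda>y. f (w y) + f' * \<kappa> * \<Gamma> y) has_real_derivative f' * D) (at x within S)"
proof -
  let ?P = "\<lambda>y. w y + \<kappa> * \<Gamma> y"
  obtain q where q: "\<And>z. f z - f (w x) = q z * (z - w x)" "isCont q (w x)" "q (w x) = f'"
    using f by (auto simp: CARAT_DERIV)
  have P1: "((\<lambda>y. (?P y - ?P x) / (y - x)) \<longlongrightarrow> D) (at x within S)"
    using P by (simp add: has_field_derivative_iff)
  have "((\<lambda>y. \<Gamma> y - \<Gamma> x) \<longlongrightarrow> 0) (at x within S)"
  proof (rule Lim_null_comparison)
    show "\<forall>\<^sub>F y in at x within S. norm (\<Gamma> y - \<Gamma> x) \<le> \<bar>y - x\<bar>"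
      using \<Gamma> by (auto simp: eventually_at_filter)
    show "((\<lambda>y. \<bar>y - x\<bar>) \<longlongrightarrow> 0) (at x within S)"
      by (rule tendsto_rabs_zero, rule LIM_zero, rule tendsto_ident_at)
  qed
  then have G: "(\<Gamma> \<longlongrightarrow> \<Gamma> x) (at x within S)" by (rule LIM_zero_cancel)
  have "(?P \<longlongrightarrow> ?P x) (at x within S)"
    using DERIV_continuous[OF P] by (simp add: continuous_within)
  from tendsto_diff[OF this tendsto_mult_left[OF G, of \<kappa>]]
  have "(w \<longlongrightarrow> w x) (at x within S)" by simp
  then have Q: "((\<lambda>y. q (w y)) \<longlongrightarrow> f') (at x within S)"
    using isCont_tendsto_compose[OF q(2)] q(3) by simp
  have "((\<lambda>y. (f' - q (w y)) * \<kappa> * ((\<Gamma> y - \<Gamma> x) / (y - x))) \<longlongrightarrow> 0) (at x within S)"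
  proof (rule Lim_null_comparison)
    show "\<forall>\<^sub>F y in at x within S. norm ((f' - q (w y)) * \<kappa> * ((\<Gamma> y - \<Gamma> x) / (y - x)))
            \<le> \<bar>(f' - q (w y)) * \<kappa>\<bar>"
      unfolding eventually_at_filter
    proof (intro always_eventually allI impI)
      fix y assume "y \<noteq> x" "y \<in> S"
      then have "\<bar>(\<Gamma> y - \<Gamma> x) / (y - x)\<bar> \<le> 1" using \<Gamma>[of y] by (simp add: abs_divide)
      then show "norm ((f' - q (w y)) * \<kappa> * ((\<Gamma> y - \<Gamma> x) / (y - x))) \<le> \<bar>(f' - q (w y)) * \<kappa>\<bar>"
        unfolding real_norm_def abs_mult by (intro mult_left_le) auto
    qed
    have "((\<lambda>y. (f' - q (w y)) * \<kappa>) \<longlongrightarrow> (f' - f') * \<kappa>) (at x within S)"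
      by (intro tendsto_intros Q)
    then show "((\<lambda>y. \<bar>(f' - q (w y)) * \<kappa>\<bar>) \<longlongrightarrow> 0) (at x within S)"
      by (intro tendsto_rabs_zero) simp
  qed
  from tendsto_add[OF tendsto_mult[OF Q P1] this]
  have "((\<lambda>y. q (w y) * ((?P y - ?P x) / (y - x)) + (f' - q (w y)) * \<kappa> * ((\<Gamma> y - \<Gamma> x) / (y - x)))
      \<longlongrightarrow> f' * D) (at x within S)" by simp
  moreover have "q (w y) * ((?P y - ?P x) / (y - x)) + (f' - q (w y)) * \<kappa> * ((\<Gamma> y - \<Gamma> x) / (y - x))
      = (f (w y) + f' * \<kappa> * \<Gamma> y - (f (w x) + f' * \<kappa> * \<Gamma> x)) / (y - x)" for y
  proof -
    have "f (w y) + f' * \<kappa> * \<Gamma> y - (f (w x) + f' * \<kappa> * \<Gamma> x)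
        = q (w y) * (w y - w x) + f' * \<kappa> * (\<Gamma> y - \<Gamma> x)"
      using q(1)[of "w y"] by (simp add: algebra_simps)
    also have "\<dots> = q (w y) * (?P y - ?P x) + (f' - q (w y)) * \<kappa> * (\<Gamma> y - \<Gamma> x)"
      by (simp add: algebra_simps)
    finally show ?thesis by (simp add: add_divide_distrib)
  qed
  ultimately show ?thesis by (simp add: has_field_derivative_iff)
qed

lemma zero_derivative_imp_const:
  fixes f :: "real \<Rightarrow> real"
  assumes "\<And>x. x \<in> {0..1} \<Longrightarrow> (f has_real_derivative 0) (at x within {0..1})" "x \<in> {0..1}"
  shows "f x = f 0"
  using has_field_derivative_zero_constant[of "{0..1}" f] assms by fastforce

section \<open>The drift equation and the exponential weight determine each other\<close>

lemma ln_variance_derivative: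
  assumes "(F has_real_derivative F x * (1 - F x) / u) (at x within S)" "0 < F x" "F x < 1"
  shows "((\<lambda>y. ln (F y * (1 - F y))) has_real_derivative (1 - 2 * F x) / u) (at x within S)"
proof -
  have D: "((\<lambda>y. F y * (1 - F y)) has_real_derivative (1 - 2 * F x) * (F x * (1 - F x) / u)) (at x within S)"
    by (rule DERIV_cong[OF DERIV_mult[OF assms(1) DERIV_diff[OF DERIV_const[of 1] assms(1)]]])
       (simp add: algebra_simps add_divide_distrib diff_divide_distrib)
  have pos: "0 < F x * (1 - F x)" using assms by simp
  have "inverse V * (b * (V / u)) = b / u" if "V \<noteq> 0" for V b :: real
    using that by simp
  from this[of "F x * (1 - F x)" "1 - 2 * F x"] pos
  have "inverse (F x * (1 - F x)) * ((1 - 2 * F x) * (F x * (1 - F x) / u)) = (1 - 2 * F x) / u"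
    by linarith
  with DERIV_chain2[OF DERIV_ln[OF pos] D] show ?thesis by (rule DERIV_cong)
qed

lemma weight_of_drift:
  fixes F u :: "real \<Rightarrow> real"
  assumes g: "\<gamma> \<in> M_ac"
    and F: "\<And>x. x \<in> {0..1} \<Longrightarrow> (F has_real_derivative F x * (1 - F x) / u x) (at x within {0..1})"
    and F01: "\<And>x. x \<in> {0..1} \<Longrightarrow> 0 < F x \<and> F x < 1"
    and u: "\<And>x. x \<in> {0..1} \<Longrightarrow> 0 < u x \<and> u x = v + integral {0..x} (\<lambda>z. 1 - \<gamma> z) - integral {0..x} F"
    and x: "x \<in> {0..1}"
  shows "exp (integral {0..x} (\<lambda>z. (\<gamma> z - F z) / u z)) = F x * (1 - F x) / u x * (u 0 / (F 0 * (1 - F 0)))"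
proof -
  let ?\<Gamma> = "\<lambda>y. integral {0..y} \<gamma>" and ?G = "\<lambda>y. integral {0..y} (\<lambda>z. (\<gamma> z - F z) / u z)"
  have cF: "continuous_on {0..1} F" by (rule DERIV_continuous_on[OF F])
  have ueq: "u y + ?\<Gamma> y = v + y - integral {0..y} F" if "y \<in> {0..1}" for y
  proof -
    have "integral {0..y} (\<lambda>z. 1 - \<gamma> z) = y - ?\<Gamma> y"
      using that by (subst integral_diff[OF _ integrable_prefix[OF M_ac_integrable[OF g] that]]) auto
    with u[OF that] show ?thesis by simp
  qed
  have uD: "((\<lambda>y. u y + 1 * ?\<Gamma> y) has_real_derivative 1 - F y) (at y within {0..1})" if y: "y \<in> {0..1}" for y
  proof -
    have "((\<lambda>y. v + y - integral {0..y} F) has_real_derivative 1 - F y) (at y within {0..1})"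
      by (rule DERIV_cong[OF DERIV_diff[OF DERIV_add[OF DERIV_const DERIV_ident]
            integral_has_real_derivative[OF cF y]]]) simp
    then show ?thesis
      by (rule has_field_derivative_transform_within[OF _ zero_less_one y]) (use ueq in simp)
  qed
  have cu: "continuous_on {0..1} u"
  proof -
    have "continuous_on {0..1} (\<lambda>y. (u y + 1 * ?\<Gamma> y) - ?\<Gamma> y)"
      by (intro continuous_on_diff DERIV_continuous_on[OF uD] indefinite_integral_continuous_1
          M_ac_integrable g)
    then show ?thesis by simp
  qed
  define E where "E y = ln (u y) + ?G y - ln (F y * (1 - F y))" for y
  have "(E has_real_derivative 0) (at y within {0..1})" if y: "y \<in> {0..1}" for y
  proof -
    have upos: "u y > 0" using u[OF y] by simp
    have 1: "((\<lambda>y'. ln (u y') + 1 / u y * 1 * ?\<Gamma> y') has_real_derivative 1 / u y * (1 - F y)) (at y within {0..1})"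
      by (intro chain_rule_modulo_lipschitz uD y M_ac_primitive_lipschitz g DERIV_ln_divide upos)
    have cc: "continuous_on {0..1} (\<lambda>z. 1 / u z)" "continuous_on {0..1} (\<lambda>z. - F z / u z)"
      using u by (intro continuous_on_divide continuous_on_const continuous_on_minus cF cu; force)+
    have 2: "((\<lambda>y'. ?G y' - 1 / u y * ?\<Gamma> y') has_real_derivative - F y / u y) (at y within {0..1})"
      using primitive_frozen_coefficient[OF g cc y] by (simp add: diff_divide_distrib)
    have 3: "((\<lambda>y. ln (F y * (1 - F y))) has_real_derivative (1 - 2 * F y) / u y) (at y within {0..1})"
      using F01[OF y] by (intro ln_variance_derivative F y) auto
    have "1 / u y * (1 - F y) + - F y / u y - (1 - 2 * F y) / u y = 0"
      using upos by (simp add: field_simps)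
    with DERIV_diff[OF DERIV_add[OF 1 2] 3] show ?thesis
      by (simp add: E_def[abs_def])
  qed
  from zero_derivative_imp_const[OF this x] have "E x = E 0" .
  then have "?G x = ln (F x * (1 - F x)) - ln (u x) + (ln (u 0) - ln (F 0 * (1 - F 0)))"
    by (simp add: E_def)
  moreover have "0 < u x" "0 < u 0" "0 < F x * (1 - F x)" "0 < F 0 * (1 - F 0)"
    using u[OF x] u[of 0] F01[OF x] F01[of 0] by auto
  ultimately show ?thesis by (simp only: exp_add exp_diff exp_ln)
qed

text \<open>This is the converse direction: taking logarithms in the weight formula expresses
  \<open>ln u\<close> through the weight integral, and exponentiating modulo the primitive of
  \<gamma> shows that \<open>u + \<Gamma>\<close> has derivative \<open>1 - F\<close>.\<close>

lemma drift_of_weight: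
  fixes F u :: "real \<Rightarrow> real"
  assumes g: "\<gamma> \<in> M_ac" and c: "0 < c"
    and F: "\<And>x. x \<in> {0..1} \<Longrightarrow> (F has_real_derivative F x * (1 - F x) / u x) (at x within {0..1})"
    and F01: "\<And>x. x \<in> {0..1} \<Longrightarrow> 0 < F x \<and> F x < 1"
    and cu: "continuous_on {0..1} u" and upos: "\<And>x. x \<in> {0..1} \<Longrightarrow> 0 < u x"
    and u: "\<And>x. x \<in> {0..1} \<Longrightarrow>
      F x * (1 - F x) / u x = c * exp (integral {0..x} (\<lambda>z. (\<gamma> z - F z) / u z))"
    and x: "x \<in> {0..1}"
  shows "u x = u 0 + integral {0..x} (\<lambda>z. 1 - \<gamma> z) - integral {0..x} F"
proof -
  let ?\<Gamma> = "\<lambda>y. integral {0..y} \<gamma>" and ?G = "\<lambda>y. integral {0..y} (\<lambda>z. (\<gamma> z - F z) / u z)"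
  have cF: "continuous_on {0..1} F" by (rule DERIV_continuous_on[OF F])
  define w where "w y = ln (F y * (1 - F y)) - ln c - ?G y" for y
  have ew: "exp (w y) = u y" if y: "y \<in> {0..1}" for y
  proof -
    have "0 < F y * (1 - F y)" using F01[OF y] by simp
    then show ?thesis
      unfolding w_def exp_diff using u[OF y] upos[OF y] c by (simp add: field_simps)
  qed
  have uD: "((\<lambda>y. u y + ?\<Gamma> y) has_real_derivative 1 - F y) (at y within {0..1})" if y: "y \<in> {0..1}" for y
  proof -
    have up: "u y > 0" using upos[OF y] by simp
    have cc: "continuous_on {0..1} (\<lambda>z. 1 / u z)" "continuous_on {0..1} (\<lambda>z. - F z / u z)"
      using upos by (intro continuous_on_divide continuous_on_const continuous_on_minus cF cu; force)+
    have 2: "((\<lambda>y'. ?G y' - 1 / u y * ?\<Gamma> y') has_real_derivative - F y / u y) (at y within {0..1})"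
      using primitive_frozen_coefficient[OF g cc y] by (simp add: diff_divide_distrib)
    have 3: "((\<lambda>y. ln (F y * (1 - F y))) has_real_derivative (1 - 2 * F y) / u y) (at y within {0..1})"
      using F01[OF y] by (intro ln_variance_derivative F y) auto
    have "(1 - 2 * F y) / u y - 0 - - F y / u y = (1 - F y) / u y"
      using up by (simp add: field_simps)
    with DERIV_diff[OF DERIV_diff[OF 3 DERIV_const[of "ln c"]] 2]
    have "((\<lambda>y'. w y' + 1 / u y * ?\<Gamma> y') has_real_derivative (1 - F y) / u y) (at y within {0..1})"
      by (simp add: w_def[abs_def] algebra_simps)
    \<comment> \<open>The derivative of \<open>exp\<close> at \<open>w y\<close> is
      \<open>u y\<close>, which turns the coefficient \<open>1 / u y\<close> of \<Gamma> into
      1.\<close>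
    from chain_rule_modulo_lipschitz[OF this M_ac_primitive_lipschitz[OF g y] DERIV_exp]
    have "((\<lambda>y'. exp (w y') + ?\<Gamma> y') has_real_derivative 1 - F y) (at y within {0..1})"
      using up ew[OF y] by simp
    then show ?thesis
      by (rule has_field_derivative_transform_within[OF _ zero_less_one y]) (use ew in simp)
  qed
  have "((\<lambda>y. u y + ?\<Gamma> y - (y - integral {0..y} F)) has_real_derivative 0) (at y within {0..1})"
    if y: "y \<in> {0..1}" for y
    using DERIV_diff[OF uD[OF y] DERIV_diff[OF DERIV_ident integral_has_real_derivative[OF cF y]]] by simp
  from zero_derivative_imp_const[OF this x]
  have "u x = u 0 + (x - ?\<Gamma> x) - integral {0..x} F" by simp
  moreover have "integral {0..x} (\<lambda>z. 1 - \<gamma> z) = x - ?\<Gamma> x"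
    using x by (subst integral_diff[OF _ integrable_prefix[OF M_ac_integrable[OF g] x]]) auto
  ultimately show ?thesis by simp
qed

subsection \<open>Shooting\<close>

definition source :: "(real \<Rightarrow> real) \<Rightarrow> real \<Rightarrow> real" where
  "source \<gamma> x = integral {0..x} (\<lambda>z. 1 - \<gamma> z)"

lemma source_integrable:
  assumes "\<gamma> \<in> M_ac"
  shows "(\<lambda>z. 1 - \<gamma> z) integrable_on {0..1}"
  by (rule integrable_diff[OF integrable_const_ivl M_ac_integrable[OF assms]])

lemma source_continuous: "\<gamma> \<in> M_ac \<Longrightarrow> continuous_on {0..1} (source \<gamma>)"
  unfolding source_def[abs_def]
  by (rule indefinite_integral_continuous_1[OF source_integrable])

text \<open>The drift is a constant plus the difference of two primitives whose increments over an
  interval both lie between 0 and its length; hence the constant is 1 rather than 2.\<close>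

lemma drift_lipschitz:
  assumes g: "\<gamma> \<in> M_ac" and s: "solves (source \<gamma>) e p v \<phi>" and x: "x \<in> {0..1}" and y: "y \<in> {0..1}"
  shows "\<bar>drift (source \<gamma>) v \<phi> y - drift (source \<gamma>) v \<phi> x\<bar> \<le> \<bar>y - x\<bar>"
proof -
  have b: "0 \<le> 1 - \<gamma> z \<and> 1 - \<gamma> z \<le> 1" if "z \<in> {0..1}" for z
    using g that by (auto simp: M_ac_def)
  have i: "(\<lambda>z. logistic (\<phi> z)) integrable_on {0..1}"
    using s by (intro logistic_integrable) (simp add: solves_def)
  have l: "0 \<le> logistic (\<phi> z) \<and> logistic (\<phi> z) \<le> 1" for z
    using logistic_pos[of "\<phi> z"] logistic_less_1[of "\<phi> z"] by simp
  have "\<bar>drift (source \<gamma>) v \<phi> b - drift (source \<gamma>) v \<phi> a\<bar> \<le> b - a"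
    if "0 \<le> a" "a \<le> b" "b \<le> 1" for a b
    using integral_difference_bounds[OF source_integrable[OF g] b that]
      integral_difference_bounds[OF i l that]
    unfolding drift_def source_def by linarith
  from this[of x y] this[of y x] show ?thesis
    using x y by (cases "x \<le> y") (auto simp: abs_minus_commute)
qed

lemma solves_0: "solves H e p v \<phi> \<Longrightarrow> \<phi> 0 = p"
  by (simp add: solves_def picard_def)

lemma source_drift_0: "drift (source \<gamma>) v \<phi> 0 = v"
  by (simp add: drift_def source_def)

lemma solves_speed_continuous:
  assumes "\<gamma> \<in> M_ac" "0 < e" "solves (source \<gamma>) e p v \<phi>"
  shows "continuous_on {0..1} (\<lambda>y. 1 / max e (drift (source \<gamma>) v \<phi> y))"
  using assms by (intro speed_continuous source_continuous logistic_integrable) (auto simp: solves_def)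

lemma solves_mono:
  assumes g: "\<gamma> \<in> M_ac" and e: "0 < e" and s: "solves (source \<gamma>) e p v \<phi>"
    and "0 \<le> x" "x \<le> y" "y \<le> 1"
  shows "\<phi> x \<le> \<phi> y"
proof -
  let ?f = "\<lambda>y. 1 / max e (drift (source \<gamma>) v \<phi> y)"
  note i = integrable_continuous_real[OF solves_speed_continuous[OF g e s]]
  have "integral {0..x} ?f \<le> integral {0..y} ?f"
    using assms(4-6) e by (intro integral_subset_le integrable_prefix[OF i]) (auto simp: max_def)
  then show ?thesis
    using s assms(4-6) by (simp add: solves_def picard_def)
qed

text \<open>Since \<^term>\<open>drift\<close> is 1-Lipschitz, a value below \<^term>\<open>e\<close> anywhere would keep it so small
  nearby that \<^term>\<open>\<phi>\<close> grows by at least \<^term>\<open>ln (1 + 1 / e)\<close>.\<close>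
lemma drift_ge_of_small_growth:
  assumes g: "\<gamma> \<in> M_ac" and e: "0 < e" and s: "solves (source \<gamma>) e p v \<phi>"
    and growth: "\<phi> 1 - \<phi> 0 < ln (1 + 1 / e)" and x: "x \<in> {0..1}"
  shows "e \<le> drift (source \<gamma>) v \<phi> x"
proof (rule ccontr)
  let ?J = "drift (source \<gamma>) v \<phi>"
  let ?f = "\<lambda>y. 1 / max e (?J y)"
  assume neg: "\<not> e \<le> ?J x"
  have x01: "0 \<le> x" "x \<le> 1" using x by auto
  have fi: "?f integrable_on {0..1}"
    by (rule integrable_continuous_real[OF solves_speed_continuous[OF g e s]])
  have i: "?f integrable_on {0..x}" "?f integrable_on {x..1}"
    using fi x01 by (auto intro: integrable_subinterval_real)
  have f: "1 / (e + \<bar>y - x\<bar>) \<le> ?f y" if y: "y \<in> {0..1}" for y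
  proof (rule divide_left_mono)
    show "max e (?J y) \<le> e + \<bar>y - x\<bar>"
      using drift_lipschitz[OF g s x y] neg by auto
  qed (use e in \<open>auto intro!: mult_pos_pos add_pos_nonneg\<close>)
  have f1: "1 / (e + x - y) \<le> ?f y" if "y \<in> {0..x}" for y
  proof -
    have "e + x - y = e + \<bar>y - x\<bar>" using that by auto
    with f[of y] that x01 show ?thesis by (simp only: atLeastAtMost_iff) simp
  qed
  have f2: "1 / (e - x + y) \<le> ?f y" if "y \<in> {x..1}" for y
  proof -
    have "e - x + y = e + \<bar>y - x\<bar>" using that by auto
    with f[of y] that x01 show ?thesis by (simp only: atLeastAtMost_iff) simp
  qed
  have "((\<lambda>y. 1 / (e + x - y)) has_integral (- ln (e + x - x) - (- ln (e + x - 0)))) {0..x}"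
  proof (rule fundamental_theorem_of_calculus[OF x01(1)])
    fix y assume "y \<in> {0..x}"
    then have "0 < e + x - y" using e by auto
    then show "((\<lambda>y. - ln (e + x - y)) has_vector_derivative 1 / (e + x - y)) (at y within {0..x})"
      unfolding has_real_derivative_iff_has_vector_derivative[symmetric]
      by (auto intro!: derivative_eq_intros)
  qed
  then have 1: "ln (e + x) - ln e \<le> integral {0..x} ?f"
    using has_integral_le[OF _ integrable_integral[OF i(1)] f1] by simp
  have "((\<lambda>y. 1 / (e - x + y)) has_integral (ln (e - x + 1) - ln (e - x + x))) {x..1}"
  proof (rule fundamental_theorem_of_calculus[OF x01(2)])
    fix y assume "y \<in> {x..1}"
    then have "0 < e - x + y" using e by auto
    then show "((\<lambda>y. ln (e - x + y)) has_vector_derivative 1 / (e - x + y)) (at y within {x..1})"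
      unfolding has_real_derivative_iff_has_vector_derivative[symmetric]
      by (auto intro!: derivative_eq_intros)
  qed
  from has_integral_le[OF this integrable_integral[OF i(2)] f2]
  have 2: "ln (e + (1 - x)) - ln e \<le> integral {x..1} ?f"
    by (simp add: algebra_simps)
  \<comment> \<open>The two explicit integrals give the growth bound
    \<open>ln ((e + x) * (e + (1 - x)) / (e * e))\<close>. The numerator exceeds its value at the
    endpoints of the unit interval by \<open>x * (1 - x)\<close>, so an endpoint is the worst
    position of \<open>x\<close>.\<close>
  have "1 + 1 / e = (e * e + e) / (e * e)"
    using e by (simp add: field_simps)
  also have "\<dots> \<le> ((e + x) * (e + (1 - x))) / (e * e)"
    using e mult_nonneg_nonneg[of x "1 - x"] x01 by (intro divide_right_mono) (auto simp: algebra_simps)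
  finally have le: "1 + 1 / e \<le> ((e + x) * (e + (1 - x))) / (e * e)" .
  have pos: "0 < 1 + 1 / e" using e by (simp add: add_pos_pos)
  then have "ln (1 + 1 / e) \<le> ln (((e + x) * (e + (1 - x))) / (e * e))"
    using le by (subst ln_le_cancel_iff[OF pos less_le_trans[OF pos le]])
  also have "\<dots> = (ln (e + x) - ln e) + (ln (e + (1 - x)) - ln e)"
    using e x01 by (simp add: ln_div ln_mult)
  also have "\<dots> \<le> integral {0..1} ?f"
    using 1 2 Henstock_Kurzweil_Integration.integral_combine[OF x01 fi] by simp
  also have "\<dots> = \<phi> 1 - \<phi> 0"
    using s solves_0[OF s] by (simp add: solves_def picard_def)
  finally show False using growth by simp
qed

text \<open>The bound in \<open>solution_dependence\<close> vanishes as the initial data converge,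
  and it controls \<phi> and the drift together. This supplies the continuity for the intermediate
  value argument.\<close>

lemma solution_continuous_in_parameter:
  fixes C :: "real set"
  assumes H: "continuous_on {0..1} H" and e: "0 < e"
    and p: "continuous_on C p" and v: "continuous_on C v"
    and s: "\<And>c. c \<in> C \<Longrightarrow> solves H e (p c) (v c) (\<Phi> c)" and x: "x \<in> {0..1}"
  shows "continuous_on C (\<lambda>c. \<Phi> c x)" "continuous_on C (\<lambda>c. drift H (v c) (\<Phi> c) x)"
proof -
  let ?b = "\<lambda>a c. (\<bar>p c - p a\<bar> + \<bar>v c - v a\<bar>) * exp (1 + 1 / e\<^sup>2)"
  have b0: "(?b a \<longlongrightarrow> 0) (at a within C)" if "a \<in> C" for a
  proof -
    have "((\<lambda>c. \<bar>p c - p a\<bar>) \<longlongrightarrow> 0) (at a within C)" "((\<lambda>c. \<bar>v c - v a\<bar>) \<longlongrightarrow> 0) (at a within C)"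
      using p v that by (auto simp: continuous_on_def intro!: tendsto_rabs_zero LIM_zero)
    from tendsto_mult_right[OF tendsto_add[OF this], of "exp (1 + 1 / e\<^sup>2)"] show ?thesis by simp
  qed
  have le: "\<bar>\<Phi> c x - \<Phi> a x\<bar> \<le> ?b a c"
    "\<bar>drift H (v c) (\<Phi> c) x - drift H (v a) (\<Phi> a) x\<bar> \<le> ?b a c" if "c \<in> C" "a \<in> C" for a c
    using solution_dependence[OF H e s[OF that(1)] s[OF that(2)] x] by linarith+
  show "continuous_on C (\<lambda>c. \<Phi> c x)"
    unfolding continuous_on_def
  proof
    fix a assume a: "a \<in> C"
    show "((\<lambda>c. \<Phi> c x) \<longlongrightarrow> \<Phi> a x) (at a within C)"
      by (rule LIM_zero_cancel, rule Lim_null_comparison[OF _ b0[OF a]])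
         (use le a in \<open>simp add: eventually_at_filter\<close>)
  qed
  show "continuous_on C (\<lambda>c. drift H (v c) (\<Phi> c) x)"
    unfolding continuous_on_def
  proof
    fix a assume a: "a \<in> C"
    show "((\<lambda>c. drift H (v c) (\<Phi> c) x) \<longlongrightarrow> drift H (v a) (\<Phi> a) x) (at a within C)"
      by (rule LIM_zero_cancel, rule Lim_null_comparison[OF _ b0[OF a]])
         (use le a in \<open>simp add: eventually_at_filter\<close>)
  qed
qed

text \<open>The boundary value problem equivalent to the fixed point equation: \<^term>\<open>c\<close> is the derivative
  of \<open>F = logistic \<circ> \<phi>\<close> at \<open>0\<close>, and the last clause is \<open>F 1 = \<beta> - B F' 1\<close>.\<close>
definition shooting ::
  "(real \<Rightarrow> real) \<Rightarrow> real \<Rightarrow> real \<Rightarrow> real \<Rightarrow> real \<Rightarrow> real \<Rightarrow> real \<Rightarrow> (real \<Rightarrow> real) \<Rightarrow> bool" where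
  "shooting \<gamma> \<alpha> \<beta> A B e c \<phi> \<longleftrightarrow>
     (let a = \<alpha> + A * c; v = a * (1 - a) / c in
      0 < c \<and> a < \<beta> \<and> solves (source \<gamma>) e (logit a) v \<phi> \<and>
      (\<forall>x\<in>{0..1}. e \<le> drift (source \<gamma>) v \<phi> x) \<and>
      (\<beta> - logistic (\<phi> 1)) * drift (source \<gamma>) v \<phi> 1 = B * (logistic (\<phi> 1) * (1 - logistic (\<phi> 1))))"

text \<open>Since \<open>\<beta> < 1\<close>, the quotient \<open>(1 - t) / (\<beta> - t)\<close>
  already increases below \<beta>, and the factor \<open>t\<close> increases too. The inequality is
  the cross-multiplied form of this for the expression that the boundary condition assigns to
  \<open>u 1\<close>, up to the factor \<open>B\<close>.\<close>

lemma boundary_flux_strict_mono: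
  fixes s t :: real
  assumes "0 < s" "s < t" "t < \<beta>" "\<beta> < 1"
  shows "s * (1 - s) * (\<beta> - t) < t * (1 - t) * (\<beta> - s)"
proof -
  have "0 < (1 - \<beta>) * (t - s)" using assms by simp
  then have "(1 - s) * (\<beta> - t) < (1 - t) * (\<beta> - s)" by (simp add: algebra_simps)
  moreover have "0 \<le> (1 - s) * (\<beta> - t)" using assms by simp
  moreover have "0 < t" using assms by simp
  ultimately have "s * ((1 - s) * (\<beta> - t)) < t * ((1 - t) * (\<beta> - s))"
    using \<open>s < t\<close> by (blast intro: mult_strict_mono)
  then show ?thesis by (simp add: mult.assoc)
qed

lemma logit_strict_mono: "0 < s \<Longrightarrow> s < t \<Longrightarrow> t < 1 \<Longrightarrow> logit s < logit t"
  by (metis logistic_less_iff logistic_logit less_trans)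

text \<open>The larger parameter would give a strictly larger \<open>F 1\<close> with a
  \<open>u 1\<close> that is no larger, whereas the condition at 1 makes \<open>u 1\<close> a
  strictly increasing function of \<open>F 1\<close>. Both solutions share the truncation level
  \<open>e\<close>, so that comparison applies.\<close>

lemma shooting_not_less:
  assumes g: "\<gamma> \<in> M_ac" and par: "0 < \<alpha>" "\<beta> < 1" "0 < A" "0 < B" and e: "0 < e"
    and s: "shooting \<gamma> \<alpha> \<beta> A B e c \<phi>" "shooting \<gamma> \<alpha> \<beta> A B e d \<psi>"
  shows "\<not> c < d"
proof
  assume cd: "c < d"
  define a b v w where "a = \<alpha> + A * c" and "b = \<alpha> + A * d"
    and "v = a * (1 - a) / c" and "w = b * (1 - b) / d"
  let ?H = "source \<gamma>"
  have c: "0 < c" "a < \<beta>" "solves ?H e (logit a) v \<phi>"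
      "\<And>x. x \<in> {0..1} \<Longrightarrow> e \<le> drift ?H v \<phi> x"
      "(\<beta> - logistic (\<phi> 1)) * drift ?H v \<phi> 1 = B * (logistic (\<phi> 1) * (1 - logistic (\<phi> 1)))"
    using s(1) by (auto simp: shooting_def Let_def a_def v_def)
  have d: "0 < d" "b < \<beta>" "solves ?H e (logit b) w \<psi>"
      "\<And>x. x \<in> {0..1} \<Longrightarrow> e \<le> drift ?H w \<psi> x"
      "(\<beta> - logistic (\<psi> 1)) * drift ?H w \<psi> 1 = B * (logistic (\<psi> 1) * (1 - logistic (\<psi> 1)))"
    using s(2) by (auto simp: shooting_def Let_def b_def w_def)
  note H = source_continuous[OF g]
  have ab: "0 < a" "a < b" using par cd c by (auto simp: a_def b_def add_pos_pos)
  have lab: "logit a < logit b" using ab d par by (intro logit_strict_mono) auto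
  \<comment> \<open>The quotient \<open>(\<alpha> + A * c) / c = \<alpha> / c + A\<close> decreases
    in \<open>c\<close>.\<close>
  have "b / d \<le> a / c"
    using c d cd par by (simp add: a_def b_def field_simps)
  then have "b / d * (1 - b) \<le> a / c * (1 - a)"
    using ab c d par by (intro mult_mono) auto
  then have wv: "w \<le> v" by (simp add: v_def w_def)
  have le: "\<phi> x \<le> \<psi> x" if "x \<in> {0..1}" for x
    using solution_comparison[OF H e c(3) d(3) less_imp_le[OF lab] wv that] .
  have i: "(\<lambda>z. logistic (\<phi> z)) integrable_on {0..1}" "(\<lambda>z. logistic (\<psi> z)) integrable_on {0..1}"
    using c(3) d(3) by (auto intro!: logistic_integrable simp: solves_def)
  have J: "drift ?H w \<psi> 1 \<le> drift ?H v \<phi> 1"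
    by (intro drift_antimono i le wv) auto
  \<comment> \<open>The strict inequality at 1 comes from the initial values alone: with a common
    initial value the comparison is weak, and replacing \<open>logit a\<close> by
    \<open>logit b\<close> adds a strict gap.\<close>
  have "picard ?H e (logit a) v \<phi> 1 \<le> picard ?H e (logit a) w \<psi> 1"
    by (intro picard_mono H e i le wv) auto
  with c(3) d(3) lab have "\<phi> 1 < \<psi> 1"
    by (simp add: solves_def picard_def)
  let ?s = "logistic (\<phi> 1)" and ?t = "logistic (\<psi> 1)"
  have st: "0 < ?s" "?s < ?t" "?t < 1"
    using \<open>\<phi> 1 < \<psi> 1\<close> logistic_pos logistic_less_1 by auto
  have Jp: "0 < drift ?H w \<psi> 1" using d(4)[of 1] e by simp
  \<comment> \<open>The right-hand side of the boundary condition is positive, which forces the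
    endpoint value below \<beta>.\<close>
  have "0 < (\<beta> - ?t) * drift ?H w \<psi> 1"
    unfolding d(5) using st par logistic_pos by (intro mult_pos_pos) auto
  then have tb: "?t < \<beta>" using Jp by (simp add: zero_less_mult_iff)
  have "B * (?t * (1 - ?t)) * (\<beta> - ?s) = drift ?H w \<psi> 1 * ((\<beta> - ?t) * (\<beta> - ?s))"
    unfolding d(5)[symmetric] by (simp add: mult_ac)
  also have "\<dots> \<le> drift ?H v \<phi> 1 * ((\<beta> - ?t) * (\<beta> - ?s))"
    using tb st(2) by (intro mult_right_mono[OF J] mult_nonneg_nonneg) linarith+
  also have "\<dots> = B * (?s * (1 - ?s)) * (\<beta> - ?t)"
    unfolding c(5)[symmetric] by (simp add: mult_ac)
  finally have "?t * (1 - ?t) * (\<beta> - ?s) \<le> ?s * (1 - ?s) * (\<beta> - ?t)"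
    using par by (simp add: mult.assoc)
  with boundary_flux_strict_mono[OF st(1,2) tb par(2)] show False by simp
qed

lemma shooting_unique:
  assumes g: "\<gamma> \<in> M_ac" and par: "0 < \<alpha>" "\<beta> < 1" "0 < A" "0 < B" and e: "0 < e"
    and s: "shooting \<gamma> \<alpha> \<beta> A B e c \<phi>" "shooting \<gamma> \<alpha> \<beta> A B e d \<psi>" and x: "x \<in> {0..1}"
  shows "\<phi> x = \<psi> x"
proof -
  have "c = d"
    using shooting_not_less[OF g par e s] shooting_not_less[OF g par e s(2,1)] by simp
  with s show ?thesis
    by (auto simp: shooting_def Let_def intro: solution_unique[OF source_continuous[OF g] e _ _ x])
qed

text \<open>The intermediate value theorem is applied to the defect \<open>h\<close> of the
  truncated boundary condition, for one level \<open>e\<close> fixed in advance. At a zero of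
  \<open>h\<close> the end value is below \<beta>, which limits the growth of \<phi> and thereby
  removes the truncation.\<close>

lemma shooting_exists:
  assumes g: "\<gamma> \<in> M_ac" and par: "0 < \<alpha>" "\<alpha> < \<beta>" "\<beta> < 1" "0 < A" "0 < B"
  shows "\<exists>e c \<phi>. 0 < e \<and> shooting \<gamma> \<alpha> \<beta> A B e c \<phi>"
proof -
  let ?H = "source \<gamma>"
  note H = source_continuous[OF g]
  \<comment> \<open>With this choice \<open>ln (1 / e) = logit \<beta> - logit \<alpha>\<close>,
    which bounds the growth of \<phi> for any solution starting above \<open>logit \<alpha>\<close>
    and ending below \<open>logit \<beta>\<close>.\<close>
  define e where "e = exp (logit \<alpha> - logit \<beta>)"
  have e: "0 < e" by (simp add: e_def)
  define a v where "a = (\<lambda>c. \<alpha> + A * c)" and "v = (\<lambda>c. a c * (1 - a c) / c)"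
  define \<Phi> where "\<Phi> c x = lim (\<lambda>n. picard_seq ?H e (logit (a c)) (v c) n x)" for c x
  have \<Phi>: "solves ?H e (logit (a c)) (v c) (\<Phi> c)" for c
    unfolding \<Phi>_def[abs_def] by (rule solution_exists[OF H e])
  \<comment> \<open>\<open>M\<close> will be a lower bound for the drift at \<open>c0\<close>. It is
    chosen so that \<open>1 / M \<le> (\<beta> - \<alpha>) / 4\<close> bounds the rise of
    \<open>F\<close>, while \<open>(\<beta> - \<alpha>) / 2 * M = 2 + B\<close> beats the term with
    \<open>B\<close> in \<open>h\<close>.\<close>
  define M where "M = (4 + 2 * B) / (\<beta> - \<alpha>)"
  have M: "0 < M" using par by (simp add: M_def add_pos_pos)
  \<comment> \<open>The first entry keeps the start \<open>a c0\<close> within a quarter of the way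
    from \<alpha> to \<beta>. The second makes \<open>v c0 \<ge> M + 1\<close>, so the 1-Lipschitz
    drift stays above \<open>M\<close> on the unit interval. The other endpoint \<open>c1\<close> is
    the parameter with \<open>a c1 = \<beta>\<close>.\<close>
  define c0 where "c0 = min ((\<beta> - \<alpha>) / (4 * A)) (\<alpha> * (1 - \<beta>) / (M + 1))"
  define c1 where "c1 = (\<beta> - \<alpha>) / A"
  have c0: "0 < c0" using par M by (simp add: c0_def)
  have "c0 \<le> (\<beta> - \<alpha>) / (4 * A)" by (simp add: c0_def)
  then have Ac0: "A * c0 \<le> (\<beta> - \<alpha>) / 4" using par by (simp add: field_simps)
  have c01: "c0 \<le> c1"
  proof -
    have "A * c0 \<le> \<beta> - \<alpha>" using Ac0 par by simp
    then show ?thesis using par by (simp add: c1_def field_simps)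
  qed
  have a: "\<alpha> < a c \<and> a c \<le> \<beta>" if "c \<in> {c0..c1}" for c
  proof -
    have "0 < c" "c \<le> c1" using that c0 by auto
    then show ?thesis using par by (simp add: a_def c1_def field_simps)
  qed
  let ?F = "\<lambda>c. logistic (\<Phi> c 1)" and ?J = "\<lambda>c. drift ?H (v c) (\<Phi> c)"
  \<comment> \<open>The drift enters through \<open>max e\<close>, hence as a positive factor, so
    the sign of the first product is that of \<open>\<beta> - ?F c\<close> even before the
    truncation is known to be inactive.\<close>
  define h where "h c = (\<beta> - ?F c) * max e (?J c 1) - B * (?F c * (1 - ?F c))" for c
  have ca: "continuous_on {c0..c1} a"
    unfolding a_def by (intro continuous_intros)
  have cp: "continuous_on {c0..c1} (\<lambda>c. logit (a c))"
    unfolding logit_def using a par by (intro continuous_intros ca) force+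
  have cv: "continuous_on {c0..c1} v"
    unfolding v_def using c0 by (intro continuous_intros ca) auto
  have ch: "continuous_on {c0..c1} h"
    unfolding h_def[abs_def]
    by (intro continuous_on_diff continuous_on_mult continuous_on_const continuous_on_max
        continuous_on_logistic solution_continuous_in_parameter[OF H e cp cv \<Phi>]) auto
  have F01: "0 < ?F c" "?F c < 1" for c
    by (simp_all add: logistic_pos logistic_less_1)
  have Fa: "a c \<le> ?F c" if "c \<in> {c0..c1}" for c
  proof -
    have "logit (a c) \<le> \<Phi> c 1"
      using solves_mono[OF g e \<Phi>[of c], of 0 1] solves_0[OF \<Phi>[of c]] by simp
    then have "logistic (logit (a c)) \<le> ?F c" by simp
    then show ?thesis using a[OF that] par by (simp add: logistic_logit)
  qed
  \<comment> \<open>At \<open>c1\<close> the solution starts at \<beta> and does not decrease, so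
    the first product in \<open>h\<close> is nonpositive.\<close>
  have h1: "h c1 \<le> 0"
  proof -
    have "\<beta> = a c1" using par by (simp add: a_def c1_def)
    then have "(\<beta> - ?F c1) * max e (?J c1 1) \<le> 0"
      using Fa[of c1] c01 e by (intro mult_nonpos_nonneg) auto
    moreover have "0 \<le> B * (?F c1 * (1 - ?F c1))"
      using F01[of c1] par by simp
    ultimately show ?thesis by (simp add: h_def)
  qed
  have h0: "0 \<le> h c0"
  proof -
    have ac0: "\<alpha> < a c0" "a c0 \<le> \<beta>" using a[of c0] c01 by auto
    have "c0 \<le> \<alpha> * (1 - \<beta>) / (M + 1)" by (simp add: c0_def)
    then have "M + 1 \<le> \<alpha> * (1 - \<beta>) / c0" using c0 M by (simp add: field_simps)
    also have "\<dots> \<le> v c0"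
      unfolding v_def using ac0 par c0 by (intro divide_right_mono mult_mono) auto
    finally have J: "M \<le> ?J c0 x" if "x \<in> {0..1}" for x
      using drift_lipschitz[OF g \<Phi>[of c0] _ that, of 0] that
      by (auto simp: source_drift_0)
    have fi: "(\<lambda>y. 1 / max e (?J c0 y)) integrable_on {0..1}"
      by (rule integrable_continuous_real[OF solves_speed_continuous[OF g e \<Phi>]])
    have "\<Phi> c0 1 - \<Phi> c0 0 = integral {0..1} (\<lambda>y. 1 / max e (?J c0 y))"
      using \<Phi>[of c0] solves_0[OF \<Phi>[of c0]] by (simp add: solves_def picard_def)
    also have "\<dots> \<le> integral {0..1::real} (\<lambda>_. 1 / M)"
    proof (rule integral_le)
      fix y :: real assume "y \<in> {0..1}"
      then have "M \<le> max e (?J c0 y)" using J[of y] by auto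
      then show "1 / max e (?J c0 y) \<le> 1 / M" using M by (intro divide_left_mono) auto
    qed (use fi in auto)
    finally have "\<Phi> c0 1 - \<Phi> c0 0 \<le> 1 / M" by simp
    moreover have "\<Phi> c0 0 \<le> \<Phi> c0 1"
      using solves_mono[OF g e \<Phi>[of c0]] by simp
    ultimately have "?F c0 - logistic (\<Phi> c0 0) \<le> 1 / M"
      using logistic_lipschitz[of "\<Phi> c0 1" "\<Phi> c0 0"] by simp
    moreover have "logistic (\<Phi> c0 0) = a c0"
      using solves_0[OF \<Phi>[of c0]] ac0 par by (simp add: logistic_logit)
    moreover have "1 / M \<le> (\<beta> - \<alpha>) / 4"
      using par by (simp add: M_def field_simps)
    moreover have "a c0 \<le> \<alpha> + (\<beta> - \<alpha>) / 4" using Ac0 by (simp add: a_def)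
    ultimately have "(\<beta> - \<alpha>) / 2 \<le> \<beta> - ?F c0" by (simp add: field_simps)
    moreover have "M \<le> max e (?J c0 1)" using J[of 1] by auto
    ultimately have "(\<beta> - \<alpha>) / 2 * M \<le> (\<beta> - ?F c0) * max e (?J c0 1)"
      using par M by (intro mult_mono) auto
    moreover have "(\<beta> - \<alpha>) / 2 * M = 2 + B" using par by (simp add: M_def field_simps)
    moreover have "B * (?F c0 * (1 - ?F c0)) \<le> B * 1"
      using F01[of c0] par by (intro mult_left_mono mult_le_one) auto
    ultimately show ?thesis by (simp add: h_def)
  qed
  obtain c where c: "c0 \<le> c" "c \<le> c1" "h c = 0"
    using IVT2'[OF h1 h0 c01 ch] by blast
  then have cpos: "0 < c" and cc: "c \<in> {c0..c1}" using c0 by auto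
  have "0 < (\<beta> - ?F c) * max e (?J c 1)"
    using c(3) F01[of c] par by (simp add: h_def)
  moreover have "0 < max e (?J c 1)" using e by simp
  ultimately have Fb: "?F c < \<beta>" using e by (auto simp: zero_less_mult_iff)
  have small: "\<Phi> c 1 - \<Phi> c 0 < ln (1 + 1 / e)"
  proof -
    have "\<Phi> c 1 < logit \<beta>"
      using Fb par logistic_logit[of \<beta>] by (metis logistic_less_iff less_trans)
    moreover have "logit \<alpha> < \<Phi> c 0"
      using solves_0[OF \<Phi>[of c]] a[OF cc] par by (simp add: logit_strict_mono)
    moreover have "logit \<beta> - logit \<alpha> = ln (1 / e)"
      by (simp add: e_def ln_div)
    moreover have "ln (1 / e) \<le> ln (1 + 1 / e)"
      using e by (subst ln_le_cancel_iff) (auto simp: add_pos_pos)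
    ultimately show ?thesis by linarith
  qed
  have J: "e \<le> ?J c x" if "x \<in> {0..1}" for x
    by (rule drift_ge_of_small_growth[OF g e \<Phi> small that])
  have "(\<beta> - ?F c) * ?J c 1 = B * (?F c * (1 - ?F c))"
    using c(3) J[of 1] by (simp add: h_def max_def)
  moreover have "a c < \<beta>" using Fa[OF cc] Fb by simp
  ultimately have "shooting \<gamma> \<alpha> \<beta> A B e c (\<Phi> c)"
    using \<Phi>[of c] J cpos by (simp add: shooting_def Let_def a_def v_def)
  with e show ?thesis by blast
qed

subsection \<open>Equivalence with the boundary value problem\<close>

lemma F_class_derivative:
  assumes "F \<in> F_class \<alpha> \<beta>" "x \<in> {0..1}"
  shows "(F has_real_derivative nabla F x) (at x within {0..1})"
  using assms vector_derivative_works[of F "at x within {0..1}"]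
  by (auto simp: F_class_def C1_01_def nabla_def differentiable_on_def
      has_real_derivative_iff_has_vector_derivative)

lemma nabla_eqI:
  assumes "(F has_real_derivative D) (at x within {0..1})" "x \<in> {0..1}"
  shows "nabla F x = D"
  unfolding nabla_def using assms
  by (intro vector_derivative_within_closed_interval)
     (auto simp: has_real_derivative_iff_has_vector_derivative)

text \<open>This links the Lebesgue integrals of the fixed point equation to the gauge integrals
  used for calculus. They agree because \<open>R_op \<gamma> F\<close> is \<gamma> times a
  continuous coefficient minus a continuous function, hence absolutely integrable.\<close>

lemma R_op_integrals:
  assumes g: "\<gamma> \<in> M_ac" and F: "F \<in> F_class \<alpha> \<beta>" and par: "0 < \<alpha>" "\<beta> < 1"
    and x: "x \<in> {0..1}"
  shows "(LINT z:{0..x}|lebesgue. R_op \<gamma> F z) = integral {0..x} (R_op \<gamma> F)"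
    and "continuous_on {0..1} (\<lambda>y. exp (integral {0..y} (R_op \<gamma> F)))"
    and "(LINT y:{0..x}|lebesgue. exp (LINT z:{0..y}|lebesgue. R_op \<gamma> F z)) =
         integral {0..x} (\<lambda>y. exp (integral {0..y} (R_op \<gamma> F)))"
proof -
  let ?k = "\<lambda>z. nabla F z / (F z * (1 - F z))"
  have cF: "continuous_on {0..1} F"
    by (rule DERIV_continuous_on[OF F_class_derivative[OF F]])
  have "F z \<noteq> 0 \<and> 1 - F z \<noteq> 0" if "z \<in> {0..1}" for z
    using F par that by (force simp: F_class_def)
  moreover have cn: "continuous_on {0..1} (nabla F)" using F by (simp add: F_class_def C1_01_def)
  ultimately have ck: "continuous_on {0..1} ?k"
    by (intro continuous_on_divide continuous_on_mult continuous_on_diff continuous_on_const cF) auto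
  have "(\<lambda>z. \<gamma> z * ?k z - F z * ?k z) absolutely_integrable_on {0..1}"
    by (intro set_integral_diff(1) M_ac_absolutely_integrable g ck
        absolutely_integrable_continuous_real continuous_on_mult cF)
  moreover have "R_op \<gamma> F = (\<lambda>z. \<gamma> z * ?k z - F z * ?k z)"
    by (rule ext) (simp only: R_op_def left_diff_distrib)
  ultimately have R: "R_op \<gamma> F absolutely_integrable_on {0..1}" by simp
  have 1: "(LINT z:{0..y}|lebesgue. R_op \<gamma> F z) = integral {0..y} (R_op \<gamma> F)" if "y \<in> {0..1}" for y
    using that by (intro set_lebesgue_integral_eq_integral set_integrable_subset[OF R]) auto
  then show "(LINT z:{0..x}|lebesgue. R_op \<gamma> F z) = integral {0..x} (R_op \<gamma> F)"
    using x .
  show 2: "continuous_on {0..1} (\<lambda>y. exp (integral {0..y} (R_op \<gamma> F)))"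
    by (intro continuous_on_exp indefinite_integral_continuous_1
        set_lebesgue_integral_eq_integral(1) R)
  have "(LINT y:{0..x}|lebesgue. exp (LINT z:{0..y}|lebesgue. R_op \<gamma> F z)) =
        (LINT y:{0..x}|lebesgue. exp (integral {0..y} (R_op \<gamma> F)))"
    using x 1 by (intro set_lebesgue_integral_cong) auto
  also have "\<dots> = integral {0..x} (\<lambda>y. exp (integral {0..y} (R_op \<gamma> F)))"
    using x by (intro set_lebesgue_integral_eq_integral
        set_integrable_subset[OF absolutely_integrable_continuous_real[OF 2]]) auto
  finally show "(LINT y:{0..x}|lebesgue. exp (LINT z:{0..y}|lebesgue. R_op \<gamma> F z)) =
         integral {0..x} (\<lambda>y. exp (integral {0..y} (R_op \<gamma> F)))" .
qed

definition fixed_point ::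
  "(real \<Rightarrow> real) \<Rightarrow> real \<Rightarrow> real \<Rightarrow> real \<Rightarrow> real \<Rightarrow> (real \<Rightarrow> real) \<Rightarrow> bool" where
  "fixed_point \<gamma> \<alpha> \<beta> A B F \<longleftrightarrow> F \<in> F_class \<alpha> \<beta> \<and>
    (\<forall>x\<in>{0..1}.
      F x = \<alpha> + (\<beta> - \<alpha>) *
        ((A + (LINT y:{0..x}|lebesgue. exp (LINT z:{0..y}|lebesgue. R_op \<gamma> F z))) /
         (A + (LINT y:{0..1}|lebesgue. exp (LINT z:{0..y}|lebesgue. R_op \<gamma> F z))
            + B * exp (LINT y:{0..1}|lebesgue. R_op \<gamma> F y))))"

text \<open>Differentiating the equation gives \<open>F' = c * exp (\<integral> R)\<close>, and
  \<open>drift_of_weight\<close> converts this into the drift equation. Every level below the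
  minimum of \<open>u\<close> is admissible; the freedom in \<open>e\<close> later allows two fixed
  points to be compared at a common level.\<close>

lemma fixed_point_imp_shooting:
  assumes g: "\<gamma> \<in> M_ac" and par: "0 < \<alpha>" "\<alpha> < \<beta>" "\<beta> < 1" "0 < A" "0 < B"
    and fp: "fixed_point \<gamma> \<alpha> \<beta> A B F"
  shows "\<exists>c e0. 0 < e0 \<and> (\<forall>e. 0 < e \<and> e \<le> e0 \<longrightarrow> shooting \<gamma> \<alpha> \<beta> A B e c (\<lambda>x. logit (F x)))"
proof -
  have F: "F \<in> F_class \<alpha> \<beta>" using fp by (simp add: fixed_point_def)
  let ?E = "\<lambda>y. exp (integral {0..y} (R_op \<gamma> F))"
  note R = R_op_integrals[OF g F par(1,3)]
  note dF = F_class_derivative[OF F]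
  have Fb: "\<alpha> < F x" "F x < \<beta>" "0 < nabla F x" if "x \<in> {0..1}" for x
    using F that by (auto simp: F_class_def)
  have F01: "0 < F x" "F x < 1" if "x \<in> {0..1}" for x
    using Fb[OF that] par by auto
  have cF: "continuous_on {0..1} F" by (rule DERIV_continuous_on[OF dF])
  have cn: "continuous_on {0..1} (nabla F)" using F by (simp add: F_class_def C1_01_def)
  have cE: "continuous_on {0..1} ?E" using R(2)[of 0] by simp
  define Z where "Z = A + integral {0..1} ?E + B * ?E 1"
  \<comment> \<open>The weight \<open>?E\<close> equals 1 at 0, so this constant is the derivative
    of \<open>F\<close> at 0.\<close>
  define c where "c = (\<beta> - \<alpha>) / Z"
  have "0 \<le> integral {0..1} ?E"
    by (intro integral_nonneg integrable_continuous_real cE) auto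
  then have Z: "0 < Z" using par by (simp add: Z_def add_pos_nonneg add_pos_pos)
  then have c: "0 < c" using par by (simp add: c_def)
  have Feq: "F x = \<alpha> + c * (A + integral {0..x} ?E)" if x: "x \<in> {0..1}" for x
    using fp x R(1)[of 1] R(3)[of 1] R(3)[OF x] by (simp add: fixed_point_def c_def Z_def)
  have nab: "nabla F x = c * ?E x" if x: "x \<in> {0..1}" for x
  proof (rule nabla_eqI[OF _ x])
    have "((\<lambda>x. \<alpha> + c * (A + integral {0..x} ?E)) has_real_derivative c * ?E x) (at x within {0..1})"
      by (rule DERIV_cong[OF DERIV_add[OF DERIV_const DERIV_cmult[OF DERIV_add[OF DERIV_const
            integral_has_real_derivative[OF cE x]]]]]) simp
    then show "(F has_real_derivative c * ?E x) (at x within {0..1})"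
      by (rule has_field_derivative_transform_within[OF _ zero_less_one x]) (use Feq in simp)
  qed
  have F0: "F 0 = \<alpha> + A * c" using Feq[of 0] by simp
  have n0: "nabla F 0 = c" using nab[of 0] by simp
  \<comment> \<open>The summand \<open>B * ?E 1\<close> of the denominator \<open>Z\<close> is what
    remains of \<open>\<beta> - \<alpha> = c * Z\<close> after \<open>F 1 - \<alpha>\<close> is
    removed.\<close>
  have F1: "\<beta> - F 1 = B * nabla F 1"
  proof -
    have "c * (A + integral {0..1} ?E) = c * Z - B * (c * ?E 1)"
      by (simp add: Z_def algebra_simps)
    also have "c * Z = \<beta> - \<alpha>" using Z by (simp add: c_def)
    finally show ?thesis using Feq[of 1] nab[of 1] by simp
  qed
  define u where "u x = F x * (1 - F x) / nabla F x" for x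
  have upos: "0 < u x" if "x \<in> {0..1}" for x
    using Fb[OF that] F01[OF that] by (simp add: u_def)
  have cu: "continuous_on {0..1} u"
    unfolding u_def[abs_def] using Fb(3)
    by (intro continuous_on_divide continuous_on_mult continuous_on_diff continuous_on_const cF cn) force
  have nu: "F x * (1 - F x) / u x = nabla F x" if "x \<in> {0..1}" for x
    using Fb[OF that] F01[OF that] by (simp add: u_def)
  have Ru: "R_op \<gamma> F = (\<lambda>z. (\<gamma> z - F z) / u z)"
    by (simp add: R_op_def u_def fun_eq_iff)
  have drift_u: "u x = u 0 + integral {0..x} (\<lambda>z. 1 - \<gamma> z) - integral {0..x} F" if x: "x \<in> {0..1}" for x
  proof (rule drift_of_weight[OF g c _ _ cu upos _ x])
    show "(F has_real_derivative F y * (1 - F y) / u y) (at y within {0..1})" if "y \<in> {0..1}" for y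
      using dF[OF that] nu[OF that] by simp
    show "F y * (1 - F y) / u y = c * exp (integral {0..y} (\<lambda>z. (\<gamma> z - F z) / u z))"
      if "y \<in> {0..1}" for y
      using nab[OF that] nu[OF that] by (simp add: Ru)
  qed (use F01 in auto)
  have drift: "drift (source \<gamma>) (u 0) (\<lambda>x. logit (F x)) x = u x" if x: "x \<in> {0..1}" for x
  proof -
    have "integral {0..x} (\<lambda>z. logistic (logit (F z))) = integral {0..x} F"
      using x F01 by (intro integral_cong) (auto simp: logistic_logit)
    then show ?thesis using drift_u[OF x] by (simp add: drift_def source_def)
  qed
  obtain x0 where x0: "x0 \<in> {0..1}" "\<And>x. x \<in> {0..1} \<Longrightarrow> u x0 \<le> u x"
    using continuous_attains_inf[of "{0..1}" u] cu by auto
  have dlogit: "((\<lambda>x. logit (F x)) has_real_derivative 1 / u x) (at x within {0..1})"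
    if x: "x \<in> {0..1}" for x
    using DERIV_chain2[OF logit_has_derivative[OF F01[OF x]] dF[OF x]] by (simp add: u_def)
  have "shooting \<gamma> \<alpha> \<beta> A B e c (\<lambda>x. logit (F x))" if e: "0 < e" "e \<le> u x0" for e
  proof -
    have eu: "e \<le> u x" if "x \<in> {0..1}" for x
      using x0(2)[OF that] e by simp
    have "logit (F x) = picard (source \<gamma>) e (logit (F 0)) (u 0) (\<lambda>x. logit (F x)) x"
      if x: "x \<in> {0..1}" for x
    proof -
      have "((\<lambda>y. 1 / u y) has_integral logit (F x) - logit (F 0)) {0..x}"
      proof (rule fundamental_theorem_of_calculus)
        fix y assume "y \<in> {0..x}"
        then show "((\<lambda>x. logit (F x)) has_vector_derivative 1 / u y) (at y within {0..x})"
          using dlogit[of y] x unfolding has_real_derivative_iff_has_vector_derivative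
          by (auto intro: has_vector_derivative_within_subset)
      qed (use x in auto)
      then have "integral {0..x} (\<lambda>y. 1 / u y) = logit (F x) - logit (F 0)"
        by (rule integral_unique)
      moreover have "integral {0..x} (\<lambda>y. 1 / max e (drift (source \<gamma>) (u 0) (\<lambda>x. logit (F x)) y))
          = integral {0..x} (\<lambda>y. 1 / u y)"
      proof (rule integral_cong)
        fix y assume "y \<in> {0..x}"
        then have "y \<in> {0..1}" using x by auto
        from eu[OF this] drift[OF this]
        show "1 / max e (drift (source \<gamma>) (u 0) (\<lambda>x. logit (F x)) y) = 1 / u y" by simp
      qed
      ultimately show ?thesis
        unfolding picard_def by linarith
    qed
    then have "solves (source \<gamma>) e (logit (F 0)) (u 0) (\<lambda>x. logit (F x))"
      unfolding solves_def using DERIV_continuous_on[OF dlogit] by blast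
    moreover have "u 0 = F 0 * (1 - F 0) / c" by (simp add: u_def n0)
    moreover have "(\<beta> - F 1) * u 1 = B * (F 1 * (1 - F 1))"
      using Fb(3)[of 1] by (simp add: F1 u_def)
    moreover have "logistic (logit (F 1)) = F 1" using F01[of 1] by (simp add: logistic_logit)
    ultimately show ?thesis
      using c Fb[of 0] drift eu by (simp add: shooting_def Let_def F0)
  qed
  with upos[OF x0(1)] show ?thesis by blast
qed

lemma fixed_point_unique:
  assumes g: "\<gamma> \<in> M_ac" and par: "0 < \<alpha>" "\<alpha> < \<beta>" "\<beta> < 1" "0 < A" "0 < B"
    and fp: "fixed_point \<gamma> \<alpha> \<beta> A B F" "fixed_point \<gamma> \<alpha> \<beta> A B G"
  shows "F = G"
proof (rule extensionalityI)
  show "F \<in> extensional {0..1}" "G \<in> extensional {0..1}"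
    using fp by (auto simp: fixed_point_def F_class_def C1_01_def)
  fix x :: real assume x: "x \<in> {0..1}"
  obtain c e0 where 1: "0 < e0" "\<And>e. 0 < e \<Longrightarrow> e \<le> e0 \<Longrightarrow> shooting \<gamma> \<alpha> \<beta> A B e c (\<lambda>x. logit (F x))"
    using fixed_point_imp_shooting[OF g par fp(1)] by blast
  obtain d e1 where 2: "0 < e1" "\<And>e. 0 < e \<Longrightarrow> e \<le> e1 \<Longrightarrow> shooting \<gamma> \<alpha> \<beta> A B e d (\<lambda>x. logit (G x))"
    using fixed_point_imp_shooting[OF g par fp(2)] by blast
  \<comment> \<open>The smaller of the two levels makes both functions solutions of the same
    truncated problem.\<close>
  have "logit (F x) = logit (G x)"
    using 1(1) 2(1)
    by (intro shooting_unique[OF g par(1,3-5) _ 1(2) 2(2) x, of "min e0 e1"]) auto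
  moreover have "0 < K x \<and> K x < 1" if "K \<in> F_class \<alpha> \<beta>" for K
    using that par x by (force simp: F_class_def)
  with fp have "0 < F x \<and> F x < 1" "0 < G x \<and> G x < 1"
    unfolding fixed_point_def by blast+
  ultimately show "F x = G x" by (metis logistic_logit)
qed

text \<open>By \<open>weight_of_drift\<close> the exponential weight is
  \<open>nabla F x / c\<close>. Its integral is then explicit, and the two boundary conditions
  identify the numerator as \<open>(F x - \<alpha>) / c\<close> and the denominator as
  \<open>(\<beta> - \<alpha>) / c\<close>.\<close>

lemma shooting_imp_fixed_point:
  assumes g: "\<gamma> \<in> M_ac" and par: "0 < \<alpha>" "\<alpha> < \<beta>" "\<beta> < 1" "0 < A" "0 < B" and e: "0 < e"
    and sh: "shooting \<gamma> \<alpha> \<beta> A B e c \<phi>"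
  shows "fixed_point \<gamma> \<alpha> \<beta> A B (restrict (\<lambda>x. logistic (\<phi> x)) {0..1})"
proof -
  define a v where "a = \<alpha> + A * c" and "v = a * (1 - a) / c"
  define F where "F = restrict (\<lambda>x. logistic (\<phi> x)) {0..1}"
  define u where "u = drift (source \<gamma>) v \<phi>"
  have c: "0 < c" "a < \<beta>" and s: "solves (source \<gamma>) e (logit a) v \<phi>"
    and eu: "\<And>x. x \<in> {0..1} \<Longrightarrow> e \<le> u x"
    and bd: "(\<beta> - logistic (\<phi> 1)) * u 1 = B * (logistic (\<phi> 1) * (1 - logistic (\<phi> 1)))"
    using sh by (auto simp: shooting_def Let_def a_def v_def u_def)
  have a: "\<alpha> < a" "0 < a" "a < 1" using c par by (auto simp: a_def add_pos_pos)
  have Fx: "F x = logistic (\<phi> x)" if "x \<in> {0..1}" for x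
    using that by (simp add: F_def)
  have F01: "0 < F x" "F x < 1" if "x \<in> {0..1}" for x
    using that by (simp_all add: Fx logistic_pos logistic_less_1)
  have upos: "0 < u x" if "x \<in> {0..1}" for x using eu[OF that] e by simp
  have F0: "F 0 = a" using solves_0[OF s] a by (simp add: Fx logistic_logit)
  have u0: "u 0 = v" by (simp add: u_def source_drift_0)
  have dphi: "(\<phi> has_real_derivative 1 / u x) (at x within {0..1})" if x: "x \<in> {0..1}" for x
  proof -
    have "((\<lambda>x. logit a + integral {0..x} (\<lambda>y. 1 / max e (u y))) has_real_derivative 1 / u x) (at x within {0..1})"
      by (rule DERIV_cong[OF DERIV_add[OF DERIV_const integral_has_real_derivative[OF
            solves_speed_continuous[OF g e s, folded u_def] x]]]) (use eu[OF x] in \<open>simp add: max_def\<close>)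
    then show ?thesis
      by (rule has_field_derivative_transform_within[OF _ zero_less_one x])
         (use s in \<open>simp add: solves_def picard_def u_def\<close>)
  qed
  have dF: "(F has_real_derivative F x * (1 - F x) / u x) (at x within {0..1})" if x: "x \<in> {0..1}" for x
  proof -
    have "((\<lambda>x. logistic (\<phi> x)) has_real_derivative F x * (1 - F x) / u x) (at x within {0..1})"
      by (rule DERIV_cong[OF DERIV_chain2[OF logistic_has_derivative dphi[OF x]]]) (simp add: Fx[OF x])
    then show ?thesis
      by (rule has_field_derivative_transform_within[OF _ zero_less_one x]) (simp add: Fx)
  qed
  have nab: "nabla F x = F x * (1 - F x) / u x" if "x \<in> {0..1}" for x
    by (rule nabla_eqI[OF dF[OF that] that])
  have cu: "continuous_on {0..1} u"
    unfolding u_def by (rule solves_drift_continuous[OF source_continuous[OF g] s])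
  have cF: "continuous_on {0..1} F" by (rule DERIV_continuous_on[OF dF])
  have cn: "continuous_on {0..1} (nabla F)"
  proof -
    have "continuous_on {0..1} (\<lambda>x. F x * (1 - F x) / u x)"
      using upos by (intro continuous_on_divide continuous_on_mult continuous_on_diff
          continuous_on_const cF cu) force
    then show ?thesis by (subst continuous_on_cong[OF refl nab]) auto
  qed
  have "0 < (\<beta> - F 1) * u 1"
    using bd F01[of 1] par by (simp add: Fx)
  then have F1: "F 1 < \<beta>" using upos[of 1] by (auto simp: zero_less_mult_iff)
  have mono: "F x \<le> F y" if "0 \<le> x" "x \<le> y" "y \<le> 1" for x y
    using solves_mono[OF g e s that] that by (simp add: Fx)
  have FF: "F \<in> F_class \<alpha> \<beta>"
    unfolding F_class_def C1_01_def
  proof (intro CollectI conjI ballI cn)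
    show "F \<in> extensional {0..1}" by (simp add: F_def)
    show "F differentiable_on {0..1}"
      unfolding differentiable_on_def real_differentiable_def using dF by blast
    fix x :: real assume x: "x \<in> {0..1}"
    show "\<alpha> < F x" using mono[of 0 x] x F0 a by simp
    show "F x < \<beta>" using mono[of x 1] x F1 by simp
    show "0 < nabla F x" using nab[OF x] F01[OF x] upos[OF x] by simp
  qed
  note R = R_op_integrals[OF g FF par(1,3)]
  let ?E = "\<lambda>y. exp (integral {0..y} (R_op \<gamma> F))"
  have E: "?E x = nabla F x / c" if x: "x \<in> {0..1}" for x
  proof -
    have "integral {0..x} (R_op \<gamma> F) = integral {0..x} (\<lambda>z. (\<gamma> z - F z) / u z)"
    proof (rule integral_cong)
      fix z assume "z \<in> {0..x}"
      then have z: "z \<in> {0..1}" using x by auto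
      show "R_op \<gamma> F z = (\<gamma> z - F z) / u z"
        using F01[OF z] upos[OF z] by (simp add: R_op_def nab[OF z])
    qed
    moreover have "exp (integral {0..x} (\<lambda>z. (\<gamma> z - F z) / u z))
        = F x * (1 - F x) / u x * (u 0 / (F 0 * (1 - F 0)))"
    proof (rule weight_of_drift[OF g dF _ _ x])
      fix y :: real assume y: "y \<in> {0..1}"
      have "integral {0..y} (\<lambda>z. logistic (\<phi> z)) = integral {0..y} F"
        using y by (intro integral_cong) (auto simp: Fx)
      then show "0 < u y \<and> u y = v + integral {0..y} (\<lambda>z. 1 - \<gamma> z) - integral {0..y} F"
        using upos[OF y] by (simp add: u_def drift_def source_def)
    qed (use F01 in auto)
    \<comment> \<open>The initial drift \<open>v = a * (1 - a) / c\<close> is exactly the value for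
      which the derivative of \<open>F\<close> at 0 is \<open>c\<close>.\<close>
    moreover have "u 0 / (F 0 * (1 - F 0)) = 1 / c"
      using a c by (simp add: u0 F0 v_def)
    ultimately show ?thesis using nab[OF x] by simp
  qed
  have I: "integral {0..x} ?E = (F x - a) / c" if x: "x \<in> {0..1}" for x
  proof -
    have "((\<lambda>y. ?E y) has_integral F x / c - F 0 / c) {0..x}"
    proof (rule fundamental_theorem_of_calculus)
      fix y assume y: "y \<in> {0..x}"
      then have y1: "y \<in> {0..1}" using x by auto
      have "((\<lambda>y. F y / c) has_real_derivative ?E y) (at y within {0..1})"
        unfolding E[OF y1] by (rule DERIV_cdivide[OF F_class_derivative[OF FF y1]])
      then show "((\<lambda>y. F y / c) has_vector_derivative ?E y) (at y within {0..x})"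
        using x unfolding has_real_derivative_iff_has_vector_derivative
        by (auto intro: has_vector_derivative_within_subset)
    qed (use x in auto)
    then show ?thesis by (simp add: integral_unique F0 diff_divide_distrib)
  qed
  have "B * nabla F 1 = (\<beta> - F 1) * u 1 / u 1"
    using bd nab[of 1] by (simp add: Fx)
  then have B1: "B * nabla F 1 = \<beta> - F 1"
    using upos[of 1] by simp
  \<comment> \<open>The three summands of the denominator are the increments from \<alpha> to
    \<open>a\<close>, from \<open>a\<close> to \<open>F 1\<close> and from \<open>F 1\<close> to
    \<beta>, each divided by \<open>c\<close>, so they telescope.\<close>
  have "A = (a - \<alpha>) / c" using c by (simp add: a_def)
  moreover have "B * ?E 1 = (\<beta> - F 1) / c" using E[of 1] B1 by simp
  ultimately have Z: "A + integral {0..1} ?E + B * ?E 1 = (\<beta> - \<alpha>) / c"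
    using I[of 1] by (simp add: diff_divide_distrib)
  have N: "A + integral {0..x} ?E = (F x - \<alpha>) / c" if "x \<in> {0..1}" for x
    using I[OF that] c by (simp add: a_def field_simps)
  have "F x = \<alpha> + (\<beta> - \<alpha>) *
        ((A + (LINT y:{0..x}|lebesgue. exp (LINT z:{0..y}|lebesgue. R_op \<gamma> F z))) /
         (A + (LINT y:{0..1}|lebesgue. exp (LINT z:{0..y}|lebesgue. R_op \<gamma> F z))
            + B * exp (LINT y:{0..1}|lebesgue. R_op \<gamma> F y)))" if x: "x \<in> {0..1}" for x
  proof -
    have one: "(1::real) \<in> {0..1}" by simp
    show ?thesis
      unfolding R(1)[OF one] R(3)[OF one] R(3)[OF x] Z N[OF x] using c par by simp
  qed
  then show ?thesis
    using FF unfolding fixed_point_def F_def[symmetric] by blast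
qed

theorem theorem5p2:
  fixes \<alpha> \<beta> A B :: real and \<gamma> :: "real \<Rightarrow> real"
  assumes "0 < \<alpha>" "\<alpha> < \<beta>" "\<beta> < 1" "A > 0" "B > 0"
    and "\<gamma> \<in> M_ac"
  shows "\<exists>!F. F \<in> F_class \<alpha> \<beta> \<and>
    (\<forall>x\<in>{0..1}.
      F x = \<alpha> + (\<beta> - \<alpha>) *
        ((A + (LINT y:{0..x}|lebesgue. exp (LINT z:{0..y}|lebesgue. R_op \<gamma> F z))) /
         (A + (LINT y:{0..1}|lebesgue. exp (LINT z:{0..y}|lebesgue. R_op \<gamma> F z))
            + B * exp (LINT y:{0..1}|lebesgue. R_op \<gamma> F y))))"
proof -
  obtain e c \<phi> where "0 < e" "shooting \<gamma> \<alpha> \<beta> A B e c \<phi>"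
    using shooting_exists[OF assms(6,1-5)] by blast
  from shooting_imp_fixed_point[OF assms(6,1-5) this]
  have "\<exists>!F. fixed_point \<gamma> \<alpha> \<beta> A B F"
    using fixed_point_unique[OF assms(6,1-5)] by blast
  then show ?thesis unfolding fixed_point_def .
qed

end
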